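(* Let $\eta$ be an uncountable regular cardinal. If $\mathrm{SULST}(\mathcal L_{\eta,\eta})=\delta$, then there is a cardinal $\kappa$ with $\eta\le\kappa\le\delta$ that is tall pushing up $\delta$ with closure ${<}\eta$.
   Context: $\mathcal L_{\eta,\eta}$ is the infinitary logic with conjunctions/disjunctions of fewer than $\eta$ formulas and quantification over fewer than $\eta$ variables. For a cardinal $\kappa\le\delta$, $\kappa$ is tall pushing up $\delta$ with closure ${<}\lambda$ if for every $\theta>\kappa$ there is an elementary embedding $j:V\to M$ ($M$ transitive) with critical point $\kappa$, $M^{<\lambda}\subseteq M$ and $j(\delta)>\theta$. $\mathrm{SULST}(\mathcal L)$ is the least cardinal $\delta$ such that for every language $\tau$, every $\tau$-structure $M$ of size $\gamma\ge\delta$ and every cardinal $\bar\gamma>\gamma$ there is a $\tau$-structure $\bar M$ of size $\ge\bar\gamma$ with $M\prec_{\mathcal L}\bar M$. *)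

theory Defs
  imports Main "HOL-Library.Equipollence" "HOL-Library.Countable_Set"
begin

section \<open>The set-theoretic universe\<close>

text \<open>
  The universe \<open>V\<close> of sets is a type \<open>'a\<close> on which \<open>elts x\<close> is the collection of members of the
  set \<open>x\<close>. Classes are the HOL sets of type \<open>'a set\<close>, and the schemas of
  separation and replacement are stated for arbitrary HOL predicates and functions. The axiom of
  choice is not listed because it follows from Hilbert choice together with replacement.
\<close>

class zfc =
  fixes elts :: "'a \<Rightarrow> 'a set"
  assumes extensionality: "elts x = elts y \<Longrightarrow> x = y"
    and foundation: "elts x \<noteq> {} \<Longrightarrow> \<exists>y\<in>elts x. elts y \<inter> elts x = {}"
    and pairing: "\<exists>p. elts p = {x, y}"
    and union: "\<exists>u. elts u = (\<Union>y\<in>elts x. elts y)"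
    and powerset: "\<exists>p. elts p = {y. elts y \<subseteq> elts x}"
    and infinity: "\<exists>w. (\<exists>z\<in>elts w. elts z = {}) \<and>
                       (\<forall>y\<in>elts w. \<exists>s\<in>elts w. elts s = insert y (elts y))"
    and separation: "\<exists>s. elts s = {y \<in> elts x. P y}"
    and replacement: "\<exists>r. elts r = F ` elts x"

definition small :: "'a::zfc set \<Rightarrow> bool" where
  "small A \<longleftrightarrow> (\<exists>x. elts x = A)"

definition set_of :: "'a::zfc set \<Rightarrow> 'a" where
  "set_of A = (THE x. elts x = A)"

definition kpair :: "'a::zfc \<Rightarrow> 'a \<Rightarrow> 'a" where
  "kpair x y = set_of {set_of {x}, set_of {x, y}}"

text \<open>The sequence \<open>\<langle>f \<xi> : \<xi> \<in> x\<rangle>\<close>, as an element of the universe.\<close>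

definition seq :: "'a::zfc \<Rightarrow> ('a \<Rightarrow> 'a) \<Rightarrow> 'a" where
  "seq x f = set_of ((\<lambda>\<xi>. kpair \<xi> (f \<xi>)) ` elts x)"

section \<open>Ordinals and cardinals\<close>

text \<open>
  Ordinals are von Neumann ordinals and cardinals are initial ordinals. Hence, for ordinals,
  \<open>\<alpha> < \<beta>\<close> is written \<open>\<alpha> \<in> elts \<beta>\<close> and \<open>\<alpha> \<le> \<beta>\<close> is written
  \<open>elts \<alpha> \<subseteq> elts \<beta>\<close>. Cardinalities are compared by HOL
  injections and bijections; between small sets these are sets, by replacement.
\<close>

definition trans_class :: "'a::zfc set \<Rightarrow> bool" where
  "trans_class M \<longleftrightarrow> (\<forall>x\<in>M. elts x \<subseteq> M)"

definition Ord :: "'a::zfc \<Rightarrow> bool" where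
  "Ord \<alpha> \<longleftrightarrow> trans_class (elts \<alpha>) \<and> (\<forall>\<beta>\<in>elts \<alpha>. trans_class (elts \<beta>))"

definition Card :: "'a::zfc \<Rightarrow> bool" where
  "Card \<kappa> \<longleftrightarrow> Ord \<kappa> \<and> (\<forall>\<alpha>\<in>elts \<kappa>. \<not> elts \<alpha> \<approx> elts \<kappa>)"

definition regular :: "'a::zfc \<Rightarrow> bool" where
  "regular \<kappa> \<longleftrightarrow> Card \<kappa> \<and> infinite (elts \<kappa>) \<and>
     (\<forall>A. A \<subseteq> elts \<kappa> \<and> A \<prec> elts \<kappa> \<longrightarrow> (\<exists>\<beta>\<in>elts \<kappa>. A \<subseteq> elts \<beta>))"

section \<open>Languages, structures and infinitary logic\<close>

text \<open>Symbols have finite arity; constants are function symbols of arity 0.\<close>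

record 'a lang =
  relsyms :: "'a set"
  funsyms :: "'a set"
  rel_ar :: "'a \<Rightarrow> nat"
  fun_ar :: "'a \<Rightarrow> nat"

definition language :: "'a::zfc lang \<Rightarrow> bool" where
  "language \<tau> \<longleftrightarrow> small (relsyms \<tau>) \<and> small (funsyms \<tau>)"

text \<open>
  \<open>rel_of\<close> and \<open>fun_of\<close> are relevant only for symbols of the language at hand, and for
  argument lists over the universe whose length is the arity of the symbol.
\<close>

record 'a struct =
  univ :: "'a set"
  rel_of :: "'a \<Rightarrow> 'a list \<Rightarrow> bool"
  fun_of :: "'a \<Rightarrow> 'a list \<Rightarrow> 'a"

definition "structure" :: "'a::zfc lang \<Rightarrow> 'a struct \<Rightarrow> bool" where
  "structure \<tau> M \<longleftrightarrow> small (univ M) \<and> univ M \<noteq> {} \<and>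
     (\<forall>f\<in>funsyms \<tau>. \<forall>xs\<in>lists (univ M). length xs = fun_ar \<tau> f \<longrightarrow> fun_of M f xs \<in> univ M)"

definition substructure :: "'a::zfc lang \<Rightarrow> 'a struct \<Rightarrow> 'a struct \<Rightarrow> bool" where
  "substructure \<tau> M N \<longleftrightarrow> univ M \<subseteq> univ N \<and>
     (\<forall>r\<in>relsyms \<tau>. \<forall>xs\<in>lists (univ M). length xs = rel_ar \<tau> r \<longrightarrow>
        (rel_of M r xs \<longleftrightarrow> rel_of N r xs)) \<and>
     (\<forall>f\<in>funsyms \<tau>. \<forall>xs\<in>lists (univ M). length xs = fun_ar \<tau> f \<longrightarrow>
        fun_of M f xs = fun_of N f xs)"

text \<open>
  Variables are named by elements of the universe. A conjunction or disjunction is taken over a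
  family of formulas together with its index set \<open>I\<close>; values of the family off \<open>I\<close> are
  irrelevant. The datatype imposes no size bounds: these are imposed by \<open>L_inf\<close> below.
\<close>

datatype 'a tm = Var 'a | Fun 'a "'a tm list"

datatype 'a fm =
    Eq "'a tm" "'a tm"
  | Rel 'a "'a tm list"
  | Neg "'a fm"
  | Conj "'a set" "'a \<Rightarrow> 'a fm"
  | Disj "'a set" "'a \<Rightarrow> 'a fm"
  | All "'a set" "'a fm"
  | Ex "'a set" "'a fm"

fun wf_tm :: "'a lang \<Rightarrow> 'a tm \<Rightarrow> bool" where
  "wf_tm \<tau> (Var x) \<longleftrightarrow> True"
| "wf_tm \<tau> (Fun f ts) \<longleftrightarrow>
     f \<in> funsyms \<tau> \<and> length ts = fun_ar \<tau> f \<and> (\<forall>t\<in>set ts. wf_tm \<tau> t)"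

primrec wf_fm :: "'a::zfc \<Rightarrow> 'a \<Rightarrow> 'a lang \<Rightarrow> 'a fm \<Rightarrow> bool" where
  "wf_fm \<mu> \<nu> \<tau> (Eq s t) \<longleftrightarrow> wf_tm \<tau> s \<and> wf_tm \<tau> t"
| "wf_fm \<mu> \<nu> \<tau> (Rel r ts) \<longleftrightarrow>
     r \<in> relsyms \<tau> \<and> length ts = rel_ar \<tau> r \<and> (\<forall>t\<in>set ts. wf_tm \<tau> t)"
| "wf_fm \<mu> \<nu> \<tau> (Neg \<phi>) \<longleftrightarrow> wf_fm \<mu> \<nu> \<tau> \<phi>"
| "wf_fm \<mu> \<nu> \<tau> (Conj I \<Phi>) \<longleftrightarrow> I \<prec> elts \<mu> \<and> (\<forall>i\<in>I. wf_fm \<mu> \<nu> \<tau> (\<Phi> i))"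
| "wf_fm \<mu> \<nu> \<tau> (Disj I \<Phi>) \<longleftrightarrow> I \<prec> elts \<mu> \<and> (\<forall>i\<in>I. wf_fm \<mu> \<nu> \<tau> (\<Phi> i))"
| "wf_fm \<mu> \<nu> \<tau> (All X \<phi>) \<longleftrightarrow> X \<prec> elts \<nu> \<and> wf_fm \<mu> \<nu> \<tau> \<phi>"
| "wf_fm \<mu> \<nu> \<tau> (Ex X \<phi>) \<longleftrightarrow> X \<prec> elts \<nu> \<and> wf_fm \<mu> \<nu> \<tau> \<phi>"

text \<open>
  A logic assigns to each language its set of formulas. \<open>L_inf \<mu> \<nu>\<close> is the logic with
  conjunctions and disjunctions of fewer than \<open>\<mu>\<close> formulas and quantification over
  fewer than \<open>\<nu>\<close> variables.
\<close>

type_synonym 'a logic = "'a lang \<Rightarrow> 'a fm set"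

definition L_inf :: "'a::zfc \<Rightarrow> 'a \<Rightarrow> 'a logic" where
  "L_inf \<mu> \<nu> \<tau> = {\<phi>. wf_fm \<mu> \<nu> \<tau> \<phi>}"

primrec eval_tm :: "'a struct \<Rightarrow> ('a \<Rightarrow> 'a) \<Rightarrow> 'a tm \<Rightarrow> 'a" where
  "eval_tm M a (Var x) = a x"
| "eval_tm M a (Fun f ts) = fun_of M f (map (eval_tm M a) ts)"

text \<open>\<open>reassign M X a b\<close>: the assignment \<open>b\<close> arises from \<open>a\<close> by changing the
  values of the variables in \<open>X\<close> to elements of \<open>M\<close>.\<close>

definition reassign :: "'a struct \<Rightarrow> 'a set \<Rightarrow> ('a \<Rightarrow> 'a) \<Rightarrow> ('a \<Rightarrow> 'a) \<Rightarrow> bool" where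
  "reassign M X a b \<longleftrightarrow> (\<forall>x. if x \<in> X then b x \<in> univ M else b x = a x)"

primrec sat :: "'a struct \<Rightarrow> 'a fm \<Rightarrow> ('a \<Rightarrow> 'a) \<Rightarrow> bool" where
  "sat M (Eq s t) = (\<lambda>a. eval_tm M a s = eval_tm M a t)"
| "sat M (Rel r ts) = (\<lambda>a. rel_of M r (map (eval_tm M a) ts))"
| "sat M (Neg \<phi>) = (\<lambda>a. \<not> sat M \<phi> a)"
| "sat M (Conj I \<Phi>) = (\<lambda>a. \<forall>i\<in>I. sat M (\<Phi> i) a)"
| "sat M (Disj I \<Phi>) = (\<lambda>a. \<exists>i\<in>I. sat M (\<Phi> i) a)"
| "sat M (All X \<phi>) = (\<lambda>a. \<forall>b. reassign M X a b \<longrightarrow> sat M \<phi> b)"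
| "sat M (Ex X \<phi>) = (\<lambda>a. \<exists>b. reassign M X a b \<and> sat M \<phi> b)"

definition elem_substructure :: "'a::zfc logic \<Rightarrow> 'a lang \<Rightarrow> 'a struct \<Rightarrow> 'a struct \<Rightarrow> bool" where
  "elem_substructure L \<tau> M N \<longleftrightarrow> substructure \<tau> M N \<and>
     (\<forall>\<phi>\<in>L \<tau>. \<forall>a. range a \<subseteq> univ M \<longrightarrow> (sat M \<phi> a \<longleftrightarrow> sat N \<phi> a))"

section \<open>Strong upward Loewenheim-Skolem-Tarski numbers\<close>

definition SULST_property :: "'a::zfc logic \<Rightarrow> 'a \<Rightarrow> bool" where
  "SULST_property L \<delta> \<longleftrightarrow>
     (\<forall>\<tau> M \<gamma> \<gamma>'. language \<tau> \<and> structure \<tau> M \<and>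
        Card \<gamma> \<and> univ M \<approx> elts \<gamma> \<and> elts \<delta> \<subseteq> elts \<gamma> \<and> Card \<gamma>' \<and> \<gamma> \<in> elts \<gamma>' \<longrightarrow>
        (\<exists>N. structure \<tau> N \<and> elts \<gamma>' \<lesssim> univ N \<and> elem_substructure L \<tau> M N))"

text \<open>The relation \<open>SULST(L) = \<delta>\<close>; the number need not exist for every logic.\<close>

definition is_SULST :: "'a::zfc logic \<Rightarrow> 'a \<Rightarrow> bool" where
  "is_SULST L \<delta> \<longleftrightarrow> Card \<delta> \<and> SULST_property L \<delta> \<and>
     (\<forall>\<delta>'\<in>elts \<delta>. Card \<delta>' \<longrightarrow> \<not> SULST_property L \<delta>')"

section \<open>Elementary embeddings of the universe and tall cardinals\<close>

text \<open>First-order formulas of set theory with variables \<open>v\<^sub>0, v\<^sub>1, \<dots>\<close>, and their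
  satisfaction in \<open>(M, \<in>)\<close> for a class \<open>M\<close>.\<close>

datatype set_fm =
    SMem nat nat
  | SEq nat nat
  | SNeg set_fm
  | SAnd set_fm set_fm
  | SEx nat set_fm

primrec set_sat :: "'a::zfc set \<Rightarrow> set_fm \<Rightarrow> (nat \<Rightarrow> 'a) \<Rightarrow> bool" where
  "set_sat M (SMem m n) = (\<lambda>e. e m \<in> elts (e n))"
| "set_sat M (SEq m n) = (\<lambda>e. e m = e n)"
| "set_sat M (SNeg \<phi>) = (\<lambda>e. \<not> set_sat M \<phi> e)"
| "set_sat M (SAnd \<phi> \<psi>) = (\<lambda>e. set_sat M \<phi> e \<and> set_sat M \<psi> e)"
| "set_sat M (SEx n \<phi>) = (\<lambda>e. \<exists>x\<in>M. set_sat M \<phi> (e(n := x)))"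

text \<open>\<open>j : V \<rightarrow> M\<close> is an elementary embedding.\<close>

definition elem_embedding :: "('a::zfc \<Rightarrow> 'a) \<Rightarrow> 'a set \<Rightarrow> bool" where
  "elem_embedding j M \<longleftrightarrow> range j \<subseteq> M \<and>
     (\<forall>\<phi> e. set_sat UNIV \<phi> e \<longleftrightarrow> set_sat M \<phi> (j \<circ> e))"

definition critical_point :: "('a::zfc \<Rightarrow> 'a) \<Rightarrow> 'a \<Rightarrow> bool" where
  "critical_point j \<kappa> \<longleftrightarrow> Ord \<kappa> \<and> j \<kappa> \<noteq> \<kappa> \<and> (\<forall>\<alpha>\<in>elts \<kappa>. j \<alpha> = \<alpha>)"

text \<open>\<open>M\<^sup><\<^sup>\<nu> \<subseteq> M\<close>\<close>

definition closed_under_less_seqs :: "'a::zfc set \<Rightarrow> 'a \<Rightarrow> bool" where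
  "closed_under_less_seqs M \<nu> \<longleftrightarrow>
     (\<forall>\<alpha>\<in>elts \<nu>. \<forall>f. f ` elts \<alpha> \<subseteq> M \<longrightarrow> seq \<alpha> f \<in> M)"

definition tall_pushing_up :: "'a::zfc \<Rightarrow> 'a \<Rightarrow> 'a \<Rightarrow> bool" where
  "tall_pushing_up \<kappa> \<delta> \<nu> \<longleftrightarrow> Card \<kappa> \<and> elts \<kappa> \<subseteq> elts \<delta> \<and>
     (\<forall>\<theta>. Ord \<theta> \<and> \<kappa> \<in> elts \<theta> \<longrightarrow>
        (\<exists>j M. trans_class M \<and> elem_embedding j M \<and> critical_point j \<kappa> \<and>
           closed_under_less_seqs M \<nu> \<and> \<theta> \<in> elts (j \<delta>)))"

end

theory Submission
  imports Defs
begin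

text \<open>
  Let \<open>W\<close> be the power set of \<open>\<delta>\<close>, regarded as a structure with names for all unary
  relations and functions. An \<open>\<L>\<^bsub>\<eta>,\<eta>\<^esub>\<close>-elementary extension \<open>N\<close> of
  \<open>W\<close> yields for every \<open>c \<in> N\<close> an \<open>\<eta>\<close>-complete ultrafilter on \<open>W\<close>;
  fewer than \<open>\<eta>\<close> elements of \<open>W\<close> can be coded by one, and by elementarity the same
  holds in \<open>N\<close>. Hence the direct limit of the ultrapowers of the universe is well-founded and
  closed under sequences of length \<open>< \<eta>\<close>, and it gives \<open>j\<close> with critical point at least
  \<open>\<eta>\<close>. Distinct elements of \<open>N\<close> represent distinct subsets of \<open>j \<delta>\<close>, so
  \<open>j \<delta>\<close> exceeds any given \<open>\<theta>\<close> once \<open>N\<close> is larger than the power set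
  of \<open>\<theta>\<close>. The critical point may depend on \<open>\<theta>\<close>, but it is at most \<open>\<delta>\<close>, so
  one value works for unboundedly many \<open>\<theta>\<close> and thus for all of them.
\<close>

section \<open>Small classes\<close>

lemma small_elts [simp]: "small (elts x)"
  by (auto simp: small_def)

lemma elts_set_of [simp]: "small A \<Longrightarrow> elts (set_of A) = A"
  unfolding small_def set_of_def by (metis (mono_tags, lifting) extensionality the_equality)

lemma set_of_elts [simp]: "set_of (elts x) = x"
  by (simp add: extensionality)

lemma small_subset: "small B \<Longrightarrow> A \<subseteq> B \<Longrightarrow> small A"
proof -
  assume "small B" "A \<subseteq> B"
  then obtain x where x: "elts x = B" by (auto simp: small_def)
  obtain s where "elts s = {y \<in> elts x. y \<in> A}"
    using separation[of x "\<lambda>y. y \<in> A"] by blast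
  with x \<open>A \<subseteq> B\<close> have "elts s = A" by auto
  then show "small A" by (auto simp: small_def)
qed

lemma small_image [simp]: "small A \<Longrightarrow> small (F ` A)" for F :: "'a::zfc \<Rightarrow> 'a"
proof -
  assume "small A"
  then obtain x where x: "elts x = A" by (auto simp: small_def)
  obtain r where "elts r = F ` elts x" using replacement[of F x] by blast
  with x show "small (F ` A)" by (auto simp: small_def)
qed

lemma small_Union: "small A \<Longrightarrow> small (\<Union>x\<in>A. elts x)"
  unfolding small_def using union by metis

lemma small_UN:
  fixes B :: "'a::zfc \<Rightarrow> 'a set"
  assumes "small A" "\<And>x. x \<in> A \<Longrightarrow> small (B x)"
  shows "small (\<Union>x\<in>A. B x)"
proof -
  have "(\<Union>x\<in>A. B x) = (\<Union>y\<in>(\<lambda>x. set_of (B x)) ` A. elts y)"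
    using assms(2) by auto
  then show ?thesis by (simp only: small_Union small_image assms(1))
qed

lemma small_pair [simp]: "small {x, y}"
  unfolding small_def using pairing .

lemma small_sing [simp]: "small {x}"
  using small_pair[of x x] by simp

lemma small_Un: "small A \<Longrightarrow> small B \<Longrightarrow> small (A \<union> B)"
proof -
  assume "small A" "small B"
  then have "A \<union> B = (\<Union>y\<in>{set_of A, set_of B}. elts y)" by simp
  then show "small (A \<union> B)" by (simp only: small_Union small_pair)
qed

lemma small_Pow [simp]: "small A \<Longrightarrow> small {x. elts x \<subseteq> A}"
  unfolding small_def using powerset by metis

text \<open>The inverse of an injection is a HOL function, so replacement pulls \<open>A\<close>
  back from a subset of \<open>B\<close>.\<close>

lemma small_lepoll:
  fixes A B :: "'a::zfc set"
  assumes "small B" "A \<lesssim> B"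
  shows "small A"
proof -
  obtain f where f: "inj_on f A" "f ` A \<subseteq> B" using assms(2) unfolding lepoll_def by blast
  have "small (f ` A)" using small_subset[OF assms(1) f(2)] .
  then have "small (inv_into A f ` f ` A)" by (rule small_image)
  then show ?thesis using f(1) by simp
qed

lemma small_image2:
  fixes F :: "'a::zfc \<Rightarrow> 'a \<Rightarrow> 'a"
  assumes "small A" "small B"
  shows "small ((\<lambda>(x, y). F x y) ` (A \<times> B))"
proof -
  have "(\<lambda>(x, y). F x y) ` (A \<times> B) = (\<Union>x\<in>A. F x ` B)" by auto
  then show ?thesis using small_UN[of A "\<lambda>x. F x ` B"] assms by simp
qed

lemma mem_irrefl: "x \<notin> elts x"
proof
  assume "x \<in> elts x"
  moreover have e: "elts (set_of {x}) = {x}" by simp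
  ultimately show False using foundation[of "set_of {x}"] by auto
qed

text \<open>Replacement acts on sets of the universe, and \<open>nat\<close> is not one. Iterating
  successor inside the set given by \<open>infinity\<close> produces an injective copy of
  \<open>nat\<close>, from which replacement reaches \<open>range f\<close>.\<close>

lemma small_range_nat: "small (range (f :: nat \<Rightarrow> 'a::zfc))"
proof -
  obtain w z :: 'a where w: "z \<in> elts w" "\<And>y. y \<in> elts w \<Longrightarrow> \<exists>s\<in>elts w. elts s = insert y (elts y)"
    using infinity by metis
  obtain s where s: "\<And>y. y \<in> elts w \<Longrightarrow> s y \<in> elts w \<and> elts (s y) = insert y (elts y)"
    using w(2) by metis
  define h where "h = rec_nat z (\<lambda>_. s)"
  have h0: "h 0 = z" and hS: "\<And>n. h (Suc n) = s (h n)" by (simp_all add: h_def)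
  have hw: "h n \<in> elts w" for n by (induction n) (simp_all add: h0 hS w(1) s)
  have mem: "m < n \<Longrightarrow> h m \<in> elts (h n)" for m n
    by (induction n) (auto simp: hS less_Suc_eq s hw)
  have "inj h"
    by (rule injI, rule ccontr) (metis mem mem_irrefl nat_neq_iff)
  then have "range f = (f \<circ> inv h) ` range h" by (auto simp: image_iff)
  moreover have "small (range h)" by (rule small_subset[of "elts w"]) (use hw in auto)
  ultimately show ?thesis using small_image by metis
qed

lemma no_descending_mem: "\<exists>n. f (Suc n) \<notin> elts (f n)"
proof (rule ccontr)
  assume "\<not> ?thesis"
  then have *: "\<And>n. f (Suc n) \<in> elts (f n)" by blast
  have e: "elts (set_of (range f)) = range f" by (simp add: small_range_nat)
  then obtain n where "elts (f n) \<inter> range f = {}"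
    using foundation[of "set_of (range f)"] by auto
  with * show False by blast
qed

lemma wf_mem: "wf {(x, y). x \<in> elts y}"
  unfolding wf_iff_no_infinite_down_chain using no_descending_mem by auto

lemma exists_notin_small: "small A \<Longrightarrow> \<exists>v. v \<notin> A"
  by (metis elts_set_of mem_irrefl)

lemma exists_distinct: "\<exists>x y :: 'a::zfc. x \<noteq> y"
  by (metis elts_set_of insertI1 mem_irrefl small_sing)

lemma kpair_inject [simp]: "kpair x y = kpair x' y' \<longleftrightarrow> x = x' \<and> y = y'"
proof
  assume "kpair x y = kpair x' y'"
  then have "{set_of {x}, set_of {x, y}} = {set_of {x'}, set_of {x', y'}}"
    unfolding kpair_def by (metis elts_set_of small_pair)
  then have "elts ` {set_of {x}, set_of {x, y}} = elts ` {set_of {x'}, set_of {x', y'}}" by simp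
  then have "{{x}, {x, y}} = {{x'}, {x', y'}}" by simp
  then show "x = x' \<and> y = y'" by (auto simp: doubleton_eq_iff)
qed simp

lemma elts_seq: "elts (seq x f) = (\<lambda>\<xi>. kpair \<xi> (f \<xi>)) ` elts x"
  by (simp add: seq_def)

lemma seq_apply: "w \<in> elts x \<Longrightarrow> (THE y. kpair w y \<in> elts (seq x f)) = f w"
  by (rule the_equality) (auto simp: elts_seq)

lemma small_seqs:
  assumes "small Z"
  shows "small {seq x f | f. f ` elts x \<subseteq> Z}"
proof -
  let ?P = "(\<lambda>(w, z). kpair w z) ` (elts x \<times> Z)"
  have "small ?P" using assms by (intro small_image2) auto
  moreover have "{seq x f | f. f ` elts x \<subseteq> Z} \<subseteq> {s. elts s \<subseteq> ?P}"
    by (fastforce simp: elts_seq)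
  ultimately show ?thesis using small_subset[OF small_Pow] by blast
qed

text \<open>The recursion equation holds for every well-founded relation, also when some point has a
  proper class of predecessors, since \<open>set_of\<close> is total. It determines members only
  once the image of the predecessors is known to be small.\<close>

lemma collapse_exists:
  assumes "wf E"
  obtains \<pi> :: "'b \<Rightarrow> 'a::zfc" where "\<And>u. \<pi> u = set_of (\<pi> ` {x. (x, u) \<in> E})"
proof
  define F where "F = (\<lambda>(p :: 'b \<Rightarrow> 'a) u. set_of (p ` {x. (x, u) \<in> E}))"
  show "wfrec E F u = set_of (wfrec E F ` {x. (x, u) \<in> E})" for u
  proof -
    have "wfrec E F u = F (cut (wfrec E F) E u) u" using wfrec[OF assms] .
    also have "\<dots> = F (wfrec E F) u"
      unfolding F_def by (intro arg_cong[where f = set_of] image_cong) (auto simp: cut_apply)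
    finally show ?thesis by (simp add: F_def)
  qed
qed

section \<open>Ordinals and cardinals\<close>

lemma Ord_mem: "Ord \<alpha> \<Longrightarrow> \<beta> \<in> elts \<alpha> \<Longrightarrow> Ord \<beta>"
  unfolding Ord_def trans_class_def by blast

lemma Ord_trans: "Ord \<alpha> \<Longrightarrow> \<beta> \<in> elts \<alpha> \<Longrightarrow> elts \<beta> \<subseteq> elts \<alpha>"
  unfolding Ord_def trans_class_def by blast

text \<open>Double induction: if the claim fails at a pair but holds below it in each coordinate,
  each ordinal is included in the other.\<close>

lemma Ord_linear: "Ord \<alpha> \<Longrightarrow> Ord \<beta> \<Longrightarrow> \<alpha> \<in> elts \<beta> \<or> \<alpha> = \<beta> \<or> \<beta> \<in> elts \<alpha>"
proof (induction \<alpha> arbitrary: \<beta> rule: wf_induct_rule[OF wf_mem])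
  case (1 \<alpha>)
  note IH\<alpha> = 1
  show ?case using \<open>Ord \<beta>\<close>
  proof (induction \<beta> rule: wf_induct_rule[OF wf_mem])
    case (1 \<beta>)
    show ?case
    proof (rule ccontr)
      assume n: "\<not> ?case"
      have "elts \<alpha> \<subseteq> elts \<beta>"
        using IH\<alpha>(1)[OF _ _ 1(2)] Ord_mem[OF IH\<alpha>(2)] Ord_trans[OF IH\<alpha>(2)] n by blast
      moreover have "elts \<beta> \<subseteq> elts \<alpha>"
        using 1(1) Ord_mem[OF 1(2)] Ord_trans[OF 1(2)] n by blast
      ultimately show False using extensionality n by blast
    qed
  qed
qed

lemma Ord_mem_or_subset: "Ord \<alpha> \<Longrightarrow> Ord \<beta> \<Longrightarrow> \<alpha> \<in> elts \<beta> \<or> elts \<beta> \<subseteq> elts \<alpha>"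
  using Ord_linear Ord_trans by blast

lemma Ord_subset_mem: "Ord \<alpha> \<Longrightarrow> Ord \<beta> \<Longrightarrow> elts \<alpha> \<subseteq> elts \<beta> \<Longrightarrow> \<beta> \<in> elts \<gamma> \<Longrightarrow> Ord \<gamma> \<Longrightarrow> \<alpha> \<in> elts \<gamma>"
  using Ord_linear[of \<alpha> \<beta>] Ord_trans[of \<gamma> \<beta>] mem_irrefl by blast

lemma Ord_set_of_UN:
  assumes "small A" "\<And>x. x \<in> A \<Longrightarrow> Ord x"
  shows "Ord (set_of (\<Union>x\<in>A. elts x))"
  using assms(2) small_Union[OF assms(1)] unfolding Ord_def trans_class_def by simp blast

text \<open>Collapsing the strict part of a well-order of \<open>A\<close> gives its order type.
  Totality makes the collapse injective, because no set is a member of itself.\<close>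

lemma Ord_eqpoll_exists:
  assumes "small (A :: 'a::zfc set)"
  shows "\<exists>\<alpha> :: 'a. Ord \<alpha> \<and> elts \<alpha> \<approx> A"
proof -
  obtain r where r: "well_order_on A r" using well_order_on by blast
  define E where "E = r - Id"
  have wf: "wf E" using r by (simp add: well_order_on_def E_def)
  have lin: "linear_order_on A r" using r by (simp add: well_order_on_def)
  have EA: "E \<subseteq> A \<times> A"
    using lin by (auto simp: linear_order_on_def partial_order_on_def preorder_on_def refl_on_def E_def)
  have tr: "trans r" "antisym r"
    using lin by (auto simp: linear_order_on_def partial_order_on_def preorder_on_def)
  then have trE: "(x, y) \<in> E \<Longrightarrow> (y, z) \<in> E \<Longrightarrow> (x, z) \<in> E" for x y z
    unfolding E_def by (auto dest: transD antisymD)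
  have tot: "x \<in> A \<Longrightarrow> y \<in> A \<Longrightarrow> x \<noteq> y \<Longrightarrow> (x, y) \<in> E \<or> (y, x) \<in> E" for x y
    using lin by (auto simp: linear_order_on_def total_on_def E_def)
  obtain \<pi> :: "'a \<Rightarrow> 'a" where "\<And>u. \<pi> u = set_of (\<pi> ` {x. (x, u) \<in> E})"
    using collapse_exists[OF wf] by blast
  moreover have "small {x. (x, u) \<in> E}" for u
    by (rule small_subset[OF assms]) (use EA in blast)
  ultimately have \<pi>: "elts (\<pi> u) = \<pi> ` {x. (x, u) \<in> E}" for u
    by (metis elts_set_of small_image)
  have inj: "inj_on \<pi> A"
  proof (rule inj_onI, rule ccontr)
    fix x y assume "x \<in> A" "y \<in> A" "\<pi> x = \<pi> y" "x \<noteq> y"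
    then show False using tot[of x y] \<pi>[of x] \<pi>[of y] mem_irrefl by (metis imageI mem_Collect_eq)
  qed
  have "Ord (set_of (\<pi> ` A))"
  proof -
    have 1: "elts (\<pi> x) \<subseteq> \<pi> ` A" for x using \<pi>[of x] EA by blast
    have 2: "elts y \<subseteq> elts (\<pi> x)" if y: "y \<in> elts (\<pi> x)" for x y
    proof -
      obtain u where "y = \<pi> u" "(u, x) \<in> E" using y \<pi>[of x] by auto
      then have "{z. (z, u) \<in> E} \<subseteq> {z. (z, x) \<in> E}" using trE by blast
      then show ?thesis unfolding \<open>y = \<pi> u\<close> \<pi> by (rule image_mono)
    qed
    have "elts (set_of (\<pi> ` A)) = \<pi> ` A" using assms by simp
    moreover have "trans_class (\<pi> ` A)" unfolding trans_class_def using 1 by (simp add: image_subset_iff)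
    moreover have "trans_class (elts (\<pi> x))" for x unfolding trans_class_def using 2 by simp
    ultimately show ?thesis by (simp add: Ord_def)
  qed
  moreover have "elts (set_of (\<pi> ` A)) \<approx> A"
    using assms inj by (simp add: inj_on_image_eqpoll_self)
  ultimately show ?thesis by blast
qed

lemma Card_eqpoll_exists:
  fixes A :: "'a::zfc set"
  assumes "small A"
  obtains \<kappa> :: "'a::zfc" where "Card \<kappa>" "elts \<kappa> \<approx> A"
proof -
  let ?S = "{\<alpha> :: 'a. Ord \<alpha> \<and> elts \<alpha> \<approx> A}"
  obtain \<alpha>0 where "\<alpha>0 \<in> ?S" using Ord_eqpoll_exists[OF assms] by blast
  then obtain \<kappa> where \<kappa>: "\<kappa> \<in> ?S" "\<And>\<beta>. (\<beta>, \<kappa>) \<in> {(x, y). x \<in> elts y} \<Longrightarrow> \<beta> \<notin> ?S"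
    by (rule wfE_min[OF wf_mem, of \<alpha>0 ?S]) blast
  then have "Card \<kappa>"
    unfolding Card_def using Ord_mem eqpoll_trans by simp blast
  with \<kappa>(1) that show ?thesis by blast
qed

lemma Card_lesspoll_mem:
  assumes "Card \<kappa>" "Card \<mu>" "elts \<kappa> \<prec> elts \<mu>"
  shows "\<kappa> \<in> elts \<mu>"
  using assms Ord_mem_or_subset[of \<kappa> \<mu>] subset_imp_lepoll lesspoll_trans1
  unfolding Card_def by (metis eqpoll_refl lesspoll_def lepoll_antisym)

lemma Card_lepoll_subset:
  assumes "Card \<kappa>" "Card \<mu>" "elts \<kappa> \<lesssim> elts \<mu>"
  shows "elts \<kappa> \<subseteq> elts \<mu>"
  using assms Ord_mem_or_subset[of \<mu> \<kappa>] Ord_trans[of \<kappa> \<mu>] subset_imp_lepoll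
  unfolding Card_def by (metis lepoll_antisym)

lemma Card_mem_lesspoll:
  assumes "Card \<kappa>" "\<alpha> \<in> elts \<kappa>"
  shows "elts \<alpha> \<prec> elts \<kappa>"
  using assms Ord_trans[of \<kappa> \<alpha>] unfolding Card_def lesspoll_def
  by (auto intro: subset_imp_lepoll)

lemma Pow_eqpoll:
  assumes "small A"
  shows "{x. elts x \<subseteq> A} \<approx> Pow A"
proof -
  have "elts ` {x. elts x \<subseteq> A} = Pow A"
  proof
    show "Pow A \<subseteq> elts ` {x. elts x \<subseteq> A}"
    proof
      fix B assume "B \<in> Pow A"
      then have "elts (set_of B) = B" "B \<subseteq> A" using small_subset[OF assms] by auto
      then show "B \<in> elts ` {x. elts x \<subseteq> A}" by (metis imageI mem_Collect_eq)
    qed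
  qed auto
  moreover have "inj_on elts {x. elts x \<subseteq> A}" by (blast intro: inj_onI extensionality)
  ultimately show ?thesis unfolding eqpoll_def bij_betw_def by blast
qed

section \<open>Ultrapowers along a coded system of ultrafilters\<close>

text \<open>
  \<open>W\<close> is an index set and \<open>N\<close> a nonstandard extension of it: \<open>ev c P\<close> says that
  \<open>c \<in> N\<close> satisfies the extension of the predicate \<open>P\<close> on \<open>W\<close>, so that
  \<open>{P. ev c P}\<close> is an ultrafilter, and \<open>act p\<close> is the extension to \<open>N\<close> of
  the function \<open>p\<close> on \<open>W\<close>.
\<close>

locale ultra_system =
  fixes \<eta> :: "'a::zfc" and W N :: "'a set"
    and ev :: "'a \<Rightarrow> ('a \<Rightarrow> bool) \<Rightarrow> bool" and act :: "('a \<Rightarrow> 'a) \<Rightarrow> 'a \<Rightarrow> 'a"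
  assumes Card_eta: "Card \<eta>" and unc: "uncountable (elts \<eta>)"
    and small_W: "small W" and small_N: "small N" and N_ne: "N \<noteq> {}"
    and ev_cong: "\<lbrakk>c \<in> N; \<And>w. w \<in> W \<Longrightarrow> P w = Q w\<rbrakk> \<Longrightarrow> ev c P = ev c Q"
    and ev_not: "c \<in> N \<Longrightarrow> ev c (\<lambda>w. \<not> P w) \<longleftrightarrow> \<not> ev c P"
    and ev_all: "\<lbrakk>c \<in> N; (I :: 'a set) \<prec> elts \<eta>\<rbrakk> \<Longrightarrow> ev c (\<lambda>w. \<forall>i\<in>I. R i w) \<longleftrightarrow> (\<forall>i\<in>I. ev c (R i))"
    and act_in: "\<lbrakk>c \<in> N; p ` W \<subseteq> W\<rbrakk> \<Longrightarrow> act p c \<in> N"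
    and ev_act: "\<lbrakk>c \<in> N; p ` W \<subseteq> W\<rbrakk> \<Longrightarrow> ev (act p c) P \<longleftrightarrow> ev c (\<lambda>w. P (p w))"
    and act_eq: "\<lbrakk>c \<in> N; p ` W \<subseteq> W; q ` W \<subseteq> W\<rbrakk> \<Longrightarrow> act p c = act q c \<longleftrightarrow> ev c (\<lambda>w. p w = q w)"
    and act_comp: "\<lbrakk>c \<in> N; p ` W \<subseteq> W; q ` W \<subseteq> W\<rbrakk> \<Longrightarrow> act p (act q c) = act (\<lambda>w. p (q w)) c"
    and act_id: "c \<in> N \<Longrightarrow> act (\<lambda>w. w) c = c"
    and code: "\<lbrakk>(I :: 'a set) \<prec> elts \<eta>; \<And>i. i \<in> I \<Longrightarrow> a i \<in> N\<rbrakk> \<Longrightarrow>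
      \<exists>c\<in>N. \<exists>p. \<forall>i\<in>I. p i ` W \<subseteq> W \<and> act (p i) c = a i"
begin

section \<open>Logical calculus of the coded ultrafilters\<close>

lemma inf_eta: "infinite (elts \<eta>)"
  using unc countable_finite by blast

lemma lesspoll_small: "I \<prec> elts \<eta> \<Longrightarrow> small (I :: 'a set)"
  by (meson lesspoll_imp_lepoll small_elts small_lepoll)

lemma two_lesspoll: "{x, y} \<prec> elts \<eta>"
  by (simp add: finite_lesspoll_infinite inf_eta)

lemma ev_True: "c \<in> N \<Longrightarrow> ev c (\<lambda>_. True)"
  using ev_all[of c "{}"] finite_lesspoll_infinite[OF inf_eta, of "{}"] by simp

lemma ev_const: "c \<in> N \<Longrightarrow> ev c (\<lambda>_. b) \<longleftrightarrow> b"
  using ev_True ev_not[of c "\<lambda>_. True"] by (cases b) simp_all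

text \<open>Binary conjunction is the instance of \<open>ev_all\<close> with two distinct sets as
  indices.\<close>

lemma ev_conj:
  assumes "c \<in> N"
  shows "ev c (\<lambda>w. P w \<and> Q w) \<longleftrightarrow> ev c P \<and> ev c Q"
proof -
  obtain x y :: 'a where "x \<noteq> y" using exists_distinct by blast
  with ev_all[OF assms two_lesspoll[of x y], of "\<lambda>i. if i = x then P else Q"] show ?thesis by simp
qed

lemma ev_mono:
  assumes "ev c P" "c \<in> N" "\<And>w. w \<in> W \<Longrightarrow> P w \<Longrightarrow> Q w"
  shows "ev c Q"
proof -
  have "ev c P = ev c (\<lambda>w. P w \<and> Q w)" using assms by (intro ev_cong) auto
  then show ?thesis using assms(1,2) ev_conj by simp
qed

lemma ev_mono2:
  assumes "ev c P" "ev c P'" "c \<in> N" "\<And>w. w \<in> W \<Longrightarrow> P w \<Longrightarrow> P' w \<Longrightarrow> Q w"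
  shows "ev c Q"
  by (rule ev_mono[of c "\<lambda>w. P w \<and> P' w"]) (use assms ev_conj in auto)

lemma ev_mono3:
  assumes "ev c P" "ev c P'" "ev c P''" "c \<in> N"
    "\<And>w. w \<in> W \<Longrightarrow> P w \<Longrightarrow> P' w \<Longrightarrow> P'' w \<Longrightarrow> Q w"
  shows "ev c Q"
  by (rule ev_mono2[of c "\<lambda>w. P w \<and> P' w" P'']) (use assms ev_conj in auto)

lemma ev_ex:
  fixes I :: "'a set"
  assumes "c \<in> N" "I \<prec> elts \<eta>"
  shows "ev c (\<lambda>w. \<exists>i\<in>I. R i w) \<longleftrightarrow> (\<exists>i\<in>I. ev c (R i))"
proof -
  have "ev c (\<lambda>w. \<not> (\<forall>i\<in>I. \<not> R i w)) \<longleftrightarrow> (\<exists>i\<in>I. ev c (R i))"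
    unfolding ev_not[OF assms(1)] ev_all[OF assms] by simp
  then show ?thesis by simp
qed

lemma ev_witness: "ev c P \<Longrightarrow> c \<in> N \<Longrightarrow> \<exists>w\<in>W. P w"
  using ev_mono[of c P "\<lambda>_. False"] ev_const[of c False] by auto

text \<open>This is where uncountability of \<eta> enters: countably many indices are fewer than
  \<eta>. It gives countable completeness and codes for countable sequences, hence well-foundedness
  of the limit.\<close>

lemma nat_index:
  obtains g :: "nat \<Rightarrow> 'a" where "inj g" "range g \<prec> elts \<eta>"
proof -
  obtain g :: "nat \<Rightarrow> 'a" where g: "inj g" "range g \<subseteq> elts \<eta>"
    using infinite_countable_subset[OF inf_eta] by blast
  have "\<not> range g \<approx> elts \<eta>"
  proof
    assume "range g \<approx> elts \<eta>"
    then have "elts \<eta> \<lesssim> range g" by (rule eqpoll_imp_lepoll[OF eqpoll_sym])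
    then have "countable (elts \<eta>)" by (rule countable_lepoll[rotated]) simp
    then show False using unc by simp
  qed
  then have "range g \<prec> elts \<eta>" using subset_imp_lepoll[OF g(2)] by (simp add: lesspoll_def)
  with g that show ?thesis by blast
qed

lemma ev_all_nat:
  assumes "c \<in> N"
  shows "ev c (\<lambda>w. \<forall>n::nat. R n w) \<longleftrightarrow> (\<forall>n. ev c (R n))"
proof -
  obtain g :: "nat \<Rightarrow> 'a" where "inj g" "range g \<prec> elts \<eta>" by (rule nat_index)
  with ev_all[OF assms this(2), of "\<lambda>i. R (inv g i)"] show ?thesis by simp
qed

lemma code_nat:
  fixes a :: "nat \<Rightarrow> 'a"
  assumes "\<And>n. a n \<in> N"
  obtains c p where "c \<in> N" "\<And>n. p n ` W \<subseteq> W" "\<And>n. a n = act (p n) c"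
proof -
  obtain g :: "nat \<Rightarrow> 'a" where g: "inj g" "range g \<prec> elts \<eta>" by (rule nat_index)
  obtain c p where "c \<in> N" "\<forall>i\<in>range g. p i ` W \<subseteq> W \<and> act (p i) c = a (inv g i)"
    using code[OF g(2), of "\<lambda>i. a (inv g i)"] assms by blast
  with g that[of c "\<lambda>n. p (g n)"] show ?thesis by simp
qed

lemma code2:
  assumes "a \<in> N" "b \<in> N"
  obtains c p q where "c \<in> N" "p ` W \<subseteq> W" "q ` W \<subseteq> W" "a = act p c" "b = act q c"
proof -
  obtain c p where *: "c \<in> N" "\<And>n. p n ` W \<subseteq> W" "\<And>n::nat. (if n = 0 then a else b) = act (p n) c"
    by (rule code_nat[of "\<lambda>n. if n = 0 then a else b"]) (use assms in auto)
  show ?thesis by (rule that[OF *(1) *(2)[of 0] *(2)[of 1]]) (use *(3)[of 0] *(3)[of 1] in auto)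
qed

lemma code3:
  assumes "a \<in> N" "b \<in> N" "b' \<in> N"
  obtains c p q r where "c \<in> N" "p ` W \<subseteq> W" "q ` W \<subseteq> W" "r ` W \<subseteq> W"
    "a = act p c" "b = act q c" "b' = act r c"
proof -
  obtain c p where *: "c \<in> N" "\<And>n. p n ` W \<subseteq> W"
    "\<And>n::nat. (if n = 0 then a else if n = 1 then b else b') = act (p n) c"
    by (rule code_nat[of "\<lambda>n. if n = 0 then a else if n = 1 then b else b'"]) (use assms in auto)
  show ?thesis by (rule that[OF *(1) *(2)[of 0] *(2)[of 1] *(2)[of 2]])
    (use *(3)[of 0] *(3)[of 1] *(3)[of 2] in auto)
qed

text \<open>
  The pair \<open>(f, a)\<close> stands for the element of the ultrapower represented by \<open>f\<close> modulo
  the ultrafilter of \<open>a\<close>. To compare two elements, they are first represented over a common code.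
\<close>

definition lift :: "('a \<Rightarrow> 'a \<Rightarrow> bool) \<Rightarrow> ('a \<Rightarrow> 'a) \<times> 'a \<Rightarrow> ('a \<Rightarrow> 'a) \<times> 'a \<Rightarrow> bool" where
  "lift R u v \<longleftrightarrow> (\<exists>c\<in>N. \<exists>p q. p ` W \<subseteq> W \<and> q ` W \<subseteq> W \<and> snd u = act p c \<and> snd v = act q c \<and>
     ev c (\<lambda>w. R (fst u (p w)) (fst v (q w))))"

lemma lift_in: "lift R u v \<Longrightarrow> snd u \<in> N \<and> snd v \<in> N"
  unfolding lift_def using act_in by auto

text \<open>The truth value does not depend on the common code. Two codes \<open>c\<close> and
  \<open>d\<close> are recoded over a third one \<open>b\<close>; by \<open>act_eq\<close> the two
  representations agree almost everywhere over \<open>b\<close>.\<close>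

lemma lift_iff:
  assumes c: "c \<in> N" and p: "p ` W \<subseteq> W" and q: "q ` W \<subseteq> W"
  shows "lift R (f, act p c) (g, act q c) \<longleftrightarrow> ev c (\<lambda>w. R (f (p w)) (g (q w)))"
proof
  assume "lift R (f, act p c) (g, act q c)"
  then obtain d p' q' where d: "d \<in> N" and p': "p' ` W \<subseteq> W" and q': "q' ` W \<subseteq> W"
    and eq: "act p c = act p' d" "act q c = act q' d" and e: "ev d (\<lambda>w. R (f (p' w)) (g (q' w)))"
    unfolding lift_def by auto
  obtain b s t where b: "b \<in> N" and s: "s ` W \<subseteq> W" and t: "t ` W \<subseteq> W"
    and cd: "c = act s b" "d = act t b" by (rule code2[OF c d])
  have comp: "(\<lambda>w. h (k w)) ` W \<subseteq> W" if "h ` W \<subseteq> W" "k ` W \<subseteq> W" for h k :: "'a \<Rightarrow> 'a"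
    using that by auto
  have "ev b (\<lambda>w. p (s w) = p' (t w))" "ev b (\<lambda>w. q (s w) = q' (t w))"
    using eq b s t p q p' q' unfolding cd by (simp_all add: act_comp comp flip: act_eq)
  moreover have "ev b (\<lambda>w. R (f (p' (t w))) (g (q' (t w))))"
    using e b t unfolding cd by (simp add: ev_act)
  ultimately have "ev b (\<lambda>w. R (f (p (s w))) (g (q (s w))))"
    by (rule ev_mono3[OF _ _ _ b]) simp
  then show "ev c (\<lambda>w. R (f (p w)) (g (q w)))"
    unfolding cd using b s by (simp add: ev_act)
qed (use assms in \<open>auto simp: lift_def\<close>)

lemma lift_iff':
  assumes "c \<in> N" "p ` W \<subseteq> W" "q ` W \<subseteq> W" "snd u = act p c" "snd v = act q c"
  shows "lift R u v \<longleftrightarrow> ev c (\<lambda>w. R (fst u (p w)) (fst v (q w)))"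
  using lift_iff[OF assms(1-3), of R "fst u" "fst v"] assms(4,5) by (metis prod.collapse)

lemma lift_same: "c \<in> N \<Longrightarrow> lift R (f, c) (g, c) \<longleftrightarrow> ev c (\<lambda>w. R (f w) (g w))"
  using lift_iff[of c "\<lambda>w. w" "\<lambda>w. w" R f g] by (simp add: act_id)

lemma lift_converse: "lift R u v \<longleftrightarrow> lift (\<lambda>x y. R y x) v u"
  unfolding lift_def by blast

lemma lift_sym: "lift (=) u v \<Longrightarrow> lift (=) v u"
  by (subst lift_converse) (simp add: eq_commute)

text \<open>All three elements are represented over one code, where the claim is substitution on a
  large set. The version for the first argument follows through
  \<open>lift_converse\<close>.\<close>

lemma lift_cong:
  assumes uv: "lift (=) u v" and xu: "lift R x u"
  shows "lift R x v"
proof -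
  have "snd u \<in> N" "snd v \<in> N" "snd x \<in> N" using lift_in[OF uv] lift_in[OF xu] by auto
  then obtain c p q r where c: "c \<in> N" "p ` W \<subseteq> W" "q ` W \<subseteq> W" "r ` W \<subseteq> W"
    and eq: "snd u = act p c" "snd v = act q c" "snd x = act r c" by (rule code3)
  have "ev c (\<lambda>w. fst u (p w) = fst v (q w))" using uv lift_iff'[OF c(1,2,3) eq(1,2)] by simp
  moreover have "ev c (\<lambda>w. R (fst x (r w)) (fst u (p w)))"
    using xu lift_iff'[OF c(1,4,2) eq(3,1)] by simp
  ultimately have "ev c (\<lambda>w. R (fst x (r w)) (fst v (q w)))"
    by (rule ev_mono2[OF _ _ c(1)]) simp
  then show ?thesis using lift_iff'[OF c(1,4,3) eq(3,2)] by simp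
qed

section \<open>Membership in the limit and its transitive collapse\<close>

definition E :: "((('a \<Rightarrow> 'a) \<times> 'a) \<times> (('a \<Rightarrow> 'a) \<times> 'a)) set" where
  "E = {(u, v). lift (\<lambda>x y. x \<in> elts y) u v}"

lemma E_iff: "(u, v) \<in> E \<longleftrightarrow> lift (\<lambda>x y. x \<in> elts y) u v"
  by (simp add: E_def)

text \<open>A descending sequence is represented over a single code. Countable completeness then
  finds one \<open>w\<close> at which all its representatives form a descending membership sequence
  in the universe.\<close>

lemma wf_E: "wf E"
  unfolding wf_iff_no_infinite_down_chain
proof
  assume "\<exists>u. \<forall>n. (u (Suc n), u n) \<in> E"
  then obtain u where u: "\<And>n. lift (\<lambda>x y. x \<in> elts y) (u (Suc n)) (u n)" by (auto simp: E_iff)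
  obtain c p where c: "c \<in> N" "\<And>n. p n ` W \<subseteq> W" "\<And>n. snd (u n) = act (p n) c"
    by (rule code_nat[of "\<lambda>n. snd (u n)", OF lift_in[OF u, THEN conjunct2]]) blast
  have "ev c (\<lambda>w. fst (u (Suc n)) (p (Suc n) w) \<in> elts (fst (u n) (p n w)))" for n
    using u[of n] lift_iff'[OF c(1) c(2) c(2) c(3) c(3), of "\<lambda>x y. x \<in> elts y"] by simp
  then have "ev c (\<lambda>w. \<forall>n. fst (u (Suc n)) (p (Suc n) w) \<in> elts (fst (u n) (p n w)))"
    using ev_all_nat[OF c(1)] by simp
  then obtain w where "\<forall>n. fst (u (Suc n)) (p (Suc n) w) \<in> elts (fst (u n) (p n w))"
    using ev_witness c(1) by blast
  then show False using no_descending_mem[of "\<lambda>n. fst (u n) (p n w)"] by simp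
qed

text \<open>\<open>E\<close> lives on pairs containing HOL functions, which are not sets of the
  universe. Hence the collapse is chosen as a solution of the recursion first, and smallness is
  supplied afterwards by \<open>small_val_preds\<close>.\<close>

definition val :: "('a \<Rightarrow> 'a) \<times> 'a \<Rightarrow> 'a" where
  "val = (SOME \<pi>. \<forall>u. \<pi> u = set_of (\<pi> ` {x. (x, u) \<in> E}))"

lemma val_unfold: "val u = set_of (val ` {x. (x, u) \<in> E})"
proof -
  have "\<exists>\<pi> :: _ \<Rightarrow> 'a. \<forall>u. \<pi> u = set_of (\<pi> ` {x. (x, u) \<in> E})"
    using collapse_exists[OF wf_E] by metis
  from someI_ex[OF this] show ?thesis unfolding val_def by blast
qed

lemma val_eqI:
  assumes "lift (=) u v"
  shows "val u = val v"
proof -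
  have "{x. (x, u) \<in> E} = {x. (x, v) \<in> E}"
    using lift_cong[OF assms] lift_cong[OF lift_sym[OF assms]] unfolding E_iff by blast
  then show ?thesis by (subst (1 2) val_unfold) simp
qed

lemma val_cong: "c \<in> N \<Longrightarrow> ev c (\<lambda>w. f w = g w) \<Longrightarrow> val (f, c) = val (g, c)"
  by (rule val_eqI) (simp add: lift_same)

lemma val_act: "c \<in> N \<Longrightarrow> p ` W \<subseteq> W \<Longrightarrow> val (f, act p c) = val (\<lambda>w. f (p w), c)"
  by (rule val_eqI, subst lift_iff'[of c p "\<lambda>w. w"]) (auto simp: act_id ev_True)

text \<open>The predecessors of \<open>(g, c)\<close> involve arbitrary HOL functions, but up to
  equality in the limit their values may be confined to a set \<open>Z\<close>. Functions from
  \<open>W\<close> to \<open>Z\<close> are coded by the sets \<open>seq W0 f\<close>, of which there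
  is only a set.\<close>

lemma small_val_preds: "small (val ` {x. (x, u) \<in> E})"
proof -
  obtain g c where u: "u = (g, c)" by fastforce
  obtain W0 where W0: "elts W0 = W" using small_W by (auto simp: small_def)
  \<comment> \<open>The union contains all values that matter; \<open>W0\<close> is added as a
    default value for the remaining arguments.\<close>
  define Z where "Z = insert W0 (\<Union>w\<in>W. elts (g w))"
  have "small ({W0} \<union> (\<Union>w\<in>W. elts (g w)))"
    by (intro small_Un small_UN small_W small_elts small_sing)
  then have "small Z" by (simp add: Z_def)
  define F where "F = (\<lambda>s d. val (\<lambda>w. THE y. kpair w y \<in> elts s, d))"
  have "small ((\<lambda>(s, d). F s d) ` ({seq W0 f | f. f ` elts W0 \<subseteq> Z} \<times> N))" (is "small ?S")
    using \<open>small Z\<close> by (intro small_image2 small_seqs small_N)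
  moreover have "val x \<in> ?S" if x: "(x, u) \<in> E" for x
  proof -
    obtain d p q where d: "d \<in> N" "p ` W \<subseteq> W" "q ` W \<subseteq> W" "snd x = act p d" "c = act q d"
      and e: "ev d (\<lambda>w. fst x (p w) \<in> elts (g (q w)))"
      using x unfolding E_iff lift_def u by auto
    define k where "k = (\<lambda>w. if fst x (p w) \<in> Z then fst x (p w) else W0)"
    have k: "k ` elts W0 \<subseteq> Z" by (auto simp: k_def Z_def)
    have "val x = val (fst x, act p d)" using d(4) by (metis prod.collapse)
    also have "\<dots> = val (\<lambda>w. fst x (p w), d)" using d by (intro val_act)
    also have "\<dots> = val (\<lambda>w. THE y. kpair w y \<in> elts (seq W0 k), d)"
    proof (intro val_cong d(1) ev_mono[OF e d(1)])
      fix w assume w: "w \<in> W" "fst x (p w) \<in> elts (g (q w))"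
      then have "fst x (p w) \<in> Z" using d(3) by (auto simp: Z_def)
      then show "fst x (p w) = (THE y. kpair w y \<in> elts (seq W0 k))"
        using w(1) by (simp add: seq_apply W0 k_def)
    qed
    finally have "val x = F (seq W0 k) d" by (simp add: F_def)
    then show ?thesis using k d(1) by (intro rev_image_eqI[of "(seq W0 k, d)"]) auto
  qed
  ultimately show ?thesis by - (rule small_subset[of ?S], auto)
qed

lemma elts_val: "elts (val u) = val ` {x. (x, u) \<in> E}"
  using val_unfold[of u] small_val_preds[of u] by simp

text \<open>By induction along \<open>E\<close>, \<open>u\<close> and \<open>v\<close> have the same
  predecessors. If they differed on a large set, choosing \<open>h w\<close> in the symmetric
  difference of their values would make \<open>(h, c)\<close> a predecessor of exactly one of
  them.\<close>

lemma val_inject: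
  assumes "val u = val v" "snd u \<in> N" "snd v \<in> N"
  shows "lift (=) u v"
  using assms
proof (induction u arbitrary: v rule: wf_induct_rule[OF wf_E])
  case (1 u)
  have lu: "(x, v) \<in> E" if x: "(x, u) \<in> E" for x
  proof -
    have "val x \<in> elts (val v)" using x elts_val[of u] 1(2) by auto
    then obtain y where y: "(y, v) \<in> E" "val x = val y" using elts_val[of v] by auto
    then have "lift (=) y x" using 1(1)[OF x] lift_in x lift_sym unfolding E_iff by blast
    then show ?thesis using y(1) lift_cong lift_converse unfolding E_iff by metis
  qed
  have lv: "(x, u) \<in> E" if x: "(x, v) \<in> E" for x
  proof -
    have "val x \<in> elts (val u)" using x elts_val[of v] 1(2) by auto
    then obtain y where y: "(y, u) \<in> E" "val y = val x" using elts_val[of u] by auto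
    then have "lift (=) y x" using 1(1)[OF y(1)] lift_in x unfolding E_iff by blast
    then show ?thesis using y(1) lift_cong lift_converse unfolding E_iff by metis
  qed
  obtain c p q where c: "c \<in> N" "p ` W \<subseteq> W" "q ` W \<subseteq> W"
    and eq: "snd u = act p c" "snd v = act q c" by (rule code2[OF 1(3,4)])
  define P where "P = (\<lambda>w x. x \<in> elts (fst u (p w)) \<longleftrightarrow> x \<notin> elts (fst v (q w)))"
  define h where "h = (\<lambda>w. SOME x. P w x)"
  have hu: "((h, c), u) \<in> E \<longleftrightarrow> ev c (\<lambda>w. h w \<in> elts (fst u (p w)))"
    unfolding E_iff by (subst lift_iff'[of c "\<lambda>w. w" p]) (use c eq act_id in auto)
  have hv: "((h, c), v) \<in> E \<longleftrightarrow> ev c (\<lambda>w. h w \<in> elts (fst v (q w)))"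
    unfolding E_iff by (subst lift_iff'[of c "\<lambda>w. w" q]) (use c eq act_id in auto)
  have "ev c (\<lambda>w. fst u (p w) = fst v (q w))"
  proof (rule ccontr)
    assume "\<not> ?thesis"
    then have ne: "ev c (\<lambda>w. fst u (p w) \<noteq> fst v (q w))" using ev_not c(1) by simp
    have *: "ev c (\<lambda>w. P w (h w))"
    proof (rule ev_mono[OF ne c(1)])
      fix w assume "fst u (p w) \<noteq> fst v (q w)"
      then have "\<exists>x. P w x" unfolding P_def using extensionality by blast
      then show "P w (h w)" unfolding h_def by (rule someI_ex)
    qed
    have "ev c (\<lambda>w. h w \<in> elts (fst u (p w))) \<longleftrightarrow> ev c (\<lambda>w. h w \<in> elts (fst v (q w)))"
      using hu hv lu lv by blast
    moreover have "ev c (\<lambda>w. h w \<in> elts (fst u (p w))) \<longleftrightarrow> \<not> ev c (\<lambda>w. h w \<in> elts (fst v (q w)))"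
      unfolding ev_not[OF c(1), symmetric]
      using ev_mono2[OF * _ c(1)] unfolding P_def by (metis (no_types, lifting))
    ultimately show False by blast
  qed
  then show ?case using lift_iff'[OF c eq] by simp
qed

lemma val_eq_iff: "c \<in> N \<Longrightarrow> val (f, c) = val (g, c) \<longleftrightarrow> ev c (\<lambda>w. f w = g w)"
  using val_inject[of "(f, c)" "(g, c)"] val_cong lift_same by auto

lemma val_mem_iff:
  assumes "c \<in> N"
  shows "val (f, c) \<in> elts (val (g, c)) \<longleftrightarrow> ev c (\<lambda>w. f w \<in> elts (g w))"
proof
  assume "val (f, c) \<in> elts (val (g, c))"
  then obtain x where x: "(x, (g, c)) \<in> E" "val (f, c) = val x" using elts_val by auto
  then have "lift (=) x (f, c)" using val_inject lift_in assms unfolding E_iff by (metis snd_conv)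
  then have "((f, c), (g, c)) \<in> E" using x(1) lift_cong lift_converse unfolding E_iff by metis
  then show "ev c (\<lambda>w. f w \<in> elts (g w))" using lift_same[OF assms] by (simp add: E_iff)
next
  assume "ev c (\<lambda>w. f w \<in> elts (g w))"
  then have "((f, c), (g, c)) \<in> E" using lift_same[OF assms] by (simp add: E_iff)
  then show "val (f, c) \<in> elts (val (g, c))" using elts_val by auto
qed

lemma elts_valE:
  assumes "x \<in> elts (val (g, c))"
  obtains d q f where "d \<in> N" "q ` W \<subseteq> W" "c = act q d" "x = val (f, d)"
    "ev d (\<lambda>w. f w \<in> elts (g (q w)))"
proof -
  obtain u where u: "(u, (g, c)) \<in> E" "x = val u" using assms elts_val by auto
  then obtain d p q where d: "d \<in> N" "p ` W \<subseteq> W" "q ` W \<subseteq> W" "snd u = act p d" "c = act q d"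
    and e: "ev d (\<lambda>w. fst u (p w) \<in> elts (g (q w)))"
    unfolding E_iff lift_def by auto
  have "x = val (fst u, act p d)" using d(4) u(2) by (metis prod.collapse)
  also have "\<dots> = val (\<lambda>w. fst u (p w), d)" using d by (intro val_act)
  finally show ?thesis using that d e by blast
qed

section \<open>The transitive target model and Los's theorem\<close>

definition target :: "'a set" where
  "target = {val (f, c) | f c. c \<in> N}"

lemma val_target: "c \<in> N \<Longrightarrow> val (f, c) \<in> target"
  by (auto simp: target_def)

lemma trans_target: "trans_class target"
  unfolding trans_class_def target_def by (blast elim: elts_valE)

text \<open>The assumption \<open>code\<close> merges the individual codes into one, and
  \<open>val_act\<close> moves the representing functions to it. Closure under short sequences rests
  on this.\<close>

lemma target_family:
  fixes I :: "'a set"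
  assumes "I \<prec> elts \<eta>" "\<And>i. i \<in> I \<Longrightarrow> x i \<in> target"
  obtains c h where "c \<in> N" "\<And>i. i \<in> I \<Longrightarrow> x i = val (h i, c)"
proof -
  have "\<forall>i\<in>I. \<exists>f a. a \<in> N \<and> x i = val (f, a)" using assms(2) unfolding target_def by blast
  then obtain f a where fa: "\<And>i. i \<in> I \<Longrightarrow> a i \<in> N \<and> x i = val (f i, a i)" by metis
  then obtain c p where "c \<in> N" "\<And>i. i \<in> I \<Longrightarrow> p i ` W \<subseteq> W \<and> act (p i) c = a i"
    using code[OF assms(1)] by metis
  then show ?thesis using that[of c "\<lambda>i w. f i (p i w)"] fa val_act by metis
qed

text \<open>By \<eta>-completeness, a function that picks one of fewer than \<eta> options at each
  point picks the same option on a large set. So the set formed pointwise acquires no new members in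
  the limit.\<close>

lemma val_set_of:
  fixes I :: "'a set"
  assumes I: "I \<prec> elts \<eta>" and c: "c \<in> N"
  shows "val (\<lambda>w. set_of ((\<lambda>i. h i w) ` I), c) = set_of ((\<lambda>i. val (h i, c)) ` I)"
proof -
  have sm: "small I" using I by (rule lesspoll_small)
  have "elts (val (\<lambda>w. set_of ((\<lambda>i. h i w) ` I), c)) = (\<lambda>i. val (h i, c)) ` I"
  proof (intro equalityI subsetI)
    fix x assume "x \<in> elts (val (\<lambda>w. set_of ((\<lambda>i. h i w) ` I), c))"
    then obtain d q f where d: "d \<in> N" "q ` W \<subseteq> W" "c = act q d" "x = val (f, d)"
      and e: "ev d (\<lambda>w. f w \<in> elts (set_of ((\<lambda>i. h i (q w)) ` I)))" by (rule elts_valE)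
    have "ev d (\<lambda>w. \<exists>i\<in>I. f w = h i (q w))" by (rule ev_mono[OF e d(1)]) (use sm in auto)
    then obtain i where i: "i \<in> I" "ev d (\<lambda>w. f w = h i (q w))" using ev_ex[OF d(1) I] by auto
    then have "x = val (\<lambda>w. h i (q w), d)" using val_cong d(1,4) by simp
    also have "\<dots> = val (h i, c)" using val_act d by simp
    finally show "x \<in> (\<lambda>i. val (h i, c)) ` I" using i(1) by blast
  next
    fix x assume "x \<in> (\<lambda>i. val (h i, c)) ` I"
    then obtain i where i: "i \<in> I" "x = val (h i, c)" by blast
    have "ev c (\<lambda>w. h i w \<in> elts (set_of ((\<lambda>i. h i w) ` I)))"
      by (rule ev_mono[OF ev_True[OF c] c]) (use sm i(1) in auto)
    then show "x \<in> elts (val (\<lambda>w. set_of ((\<lambda>i. h i w) ` I), c))"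
      using val_mem_iff[OF c] i(2) by simp
  qed
  then show ?thesis by (metis set_of_elts)
qed

text \<open>Only the quantifier needs work. A witness in the target may have its own code, so it is
  moved with the parameters to a common one; conversely, pointwise witnesses are collected into a
  Skolem function \<open>g\<close>.\<close>

lemma Los_theorem:
  "c \<in> N \<Longrightarrow> set_sat target \<phi> (\<lambda>n. val (e n, c)) \<longleftrightarrow> ev c (\<lambda>w. set_sat UNIV \<phi> (\<lambda>n. e n w))"
proof (induction \<phi> arbitrary: e c)
  case (SEx n \<phi>)
  let ?S = "\<lambda>w x. set_sat UNIV \<phi> ((\<lambda>n. e n w)(n := x))"
  have upd: "(\<lambda>m. val (e m, c))(n := val (g, c)) = (\<lambda>m. val ((e(n := g)) m, c))" for e g c
    by (rule ext) simp
  have upd': "(\<lambda>m. e m w)(n := g w) = (\<lambda>m. (e(n := g)) m w)" for e g and w :: 'a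
    by (rule ext) simp
  show ?case
  proof
    assume "set_sat target (SEx n \<phi>) (\<lambda>n. val (e n, c))"
    then obtain g b where b: "b \<in> N" and s: "set_sat target \<phi> ((\<lambda>m. val (e m, c))(n := val (g, b)))"
      by (auto simp: target_def)
    obtain d q r where d: "d \<in> N" and q: "q ` W \<subseteq> W" and r: "r ` W \<subseteq> W"
      and cb: "c = act q d" "b = act r d" by (rule code2[OF SEx(2) b])
    have "set_sat target \<phi> ((\<lambda>m. val (\<lambda>w. e m (q w), d))(n := val (\<lambda>w. g (r w), d)))"
      using s d q r unfolding cb by (simp add: val_act)
    then have "set_sat target \<phi> (\<lambda>m. val (((\<lambda>m w. e m (q w))(n := (\<lambda>w. g (r w)))) m, d))"
      using upd[of "\<lambda>m w. e m (q w)" d "\<lambda>w. g (r w)"] by simp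
    then have "ev d (\<lambda>w. set_sat UNIV \<phi> (\<lambda>m. ((\<lambda>m w. e m (q w))(n := (\<lambda>w. g (r w)))) m w))"
      using SEx(1)[OF d] by simp
    then have "ev d (\<lambda>w. \<exists>x. ?S (q w) x)"
    proof (rule ev_mono[OF _ d])
      fix w assume "set_sat UNIV \<phi> (\<lambda>m. ((\<lambda>m w. e m (q w))(n := (\<lambda>w. g (r w)))) m w)"
      then show "\<exists>x. ?S (q w) x"
        using upd'[of "\<lambda>m w. e m (q w)" w "\<lambda>w. g (r w)"] by metis
    qed
    then show "ev c (\<lambda>w. set_sat UNIV (SEx n \<phi>) (\<lambda>n. e n w))"
      unfolding cb using d q by (simp add: ev_act)
  next
    assume ex: "ev c (\<lambda>w. set_sat UNIV (SEx n \<phi>) (\<lambda>n. e n w))"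
    define g where "g = (\<lambda>w. SOME x. ?S w x)"
    have "ev c (\<lambda>w. set_sat UNIV \<phi> (\<lambda>m. (e(n := g)) m w))"
    proof (rule ev_mono[OF ex SEx(2)])
      fix w assume "set_sat UNIV (SEx n \<phi>) (\<lambda>n. e n w)"
      then have "\<exists>x. ?S w x" by simp
      then have "?S w (g w)" unfolding g_def by (rule someI_ex)
      then show "set_sat UNIV \<phi> (\<lambda>m. (e(n := g)) m w)" by (simp only: upd'[of e w g])
    qed
    then have "set_sat target \<phi> ((\<lambda>m. val (e m, c))(n := val (g, c)))"
      using SEx(1)[OF SEx(2)] upd by simp
    then show "set_sat target (SEx n \<phi>) (\<lambda>n. val (e n, c))"
      using val_target[OF SEx(2)] by auto
  qed
qed (simp_all add: val_mem_iff val_eq_iff ev_not ev_conj)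

section \<open>The embedding, its fixed ordinals and its critical point\<close>

definition j :: "'a \<Rightarrow> 'a" where
  "j x = val (\<lambda>_. x, SOME c. c \<in> N)"

text \<open>Any two codes have a common one above them, and a constant function stays constant when
  moved there.\<close>

lemma j_val:
  assumes "c \<in> N"
  shows "j x = val (\<lambda>_. x, c)"
proof -
  have "(SOME c. c \<in> N) \<in> N" using N_ne by (simp add: some_in_eq)
  then obtain d p q where "d \<in> N" "p ` W \<subseteq> W" "q ` W \<subseteq> W" "(SOME c. c \<in> N) = act p d" "c = act q d"
    using assms by (rule code2)
  then show ?thesis unfolding j_def by (simp add: val_act)
qed

lemma elem_embedding_j: "elem_embedding j target"
proof -
  obtain c where c: "c \<in> N" using N_ne by blast
  have "set_sat UNIV \<phi> e \<longleftrightarrow> set_sat target \<phi> (j \<circ> e)" for \<phi> e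
  proof -
    have "j \<circ> e = (\<lambda>n. val (\<lambda>_. e n, c))" using j_val[OF c] by auto
    then show ?thesis using Los_theorem[OF c, of \<phi> "\<lambda>n _. e n"] ev_const[OF c] by simp
  qed
  moreover have "range j \<subseteq> target" using j_val[OF c] val_target[OF c] by auto
  ultimately show ?thesis by (auto simp: elem_embedding_def)
qed

lemma j_mem_iff: "j x \<in> elts (j y) \<longleftrightarrow> x \<in> elts y"
proof -
  obtain c where c: "c \<in> N" using N_ne by blast
  then show ?thesis by (simp add: j_val[OF c] val_mem_iff ev_const)
qed

lemma mem_jE:
  assumes "x \<in> elts (j y)"
  obtains c f where "c \<in> N" "x = val (f, c)" "ev c (\<lambda>w. f w \<in> elts y)"
proof -
  obtain b where "b \<in> N" using N_ne by blast
  then show ?thesis using assms j_val elts_valE[of x "\<lambda>_. y" b] that by metis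
qed

text \<open>Both levels of transitivity are checked on representatives over a common code, which
  avoids writing ordinality as a \<open>set_fm\<close>.\<close>

lemma Ord_j:
  assumes "Ord \<alpha>"
  shows "Ord (j \<alpha>)"
proof -
  obtain b where b: "b \<in> N" using N_ne by blast
  have 1: "z \<in> elts (j \<alpha>)" if y: "y \<in> elts (j \<alpha>)" and z: "z \<in> elts y" for y z
  proof -
    obtain c f where c: "c \<in> N" and yf: "y = val (f, c)" and e: "ev c (\<lambda>w. f w \<in> elts \<alpha>)"
      using y by (rule mem_jE)
    obtain d q g where d: "d \<in> N" "q ` W \<subseteq> W" "c = act q d" "z = val (g, d)"
      "ev d (\<lambda>w. g w \<in> elts (f (q w)))" using z unfolding yf by (rule elts_valE)
    have "ev d (\<lambda>w. f (q w) \<in> elts \<alpha>)" using e d by (simp add: ev_act)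
    then have "ev d (\<lambda>w. g w \<in> elts \<alpha>)"
      using d(5) by (rule ev_mono2[OF _ _ d(1)]) (use Ord_trans[OF assms] in blast)
    then show ?thesis using d val_mem_iff[OF d(1)] j_val[OF d(1)] by simp
  qed
  have 2: "u \<in> elts y" if y: "y \<in> elts (j \<alpha>)" and z: "z \<in> elts y" and u: "u \<in> elts z" for y z u
  proof -
    have "elts x \<subseteq> target" if "x \<in> target" for x
      using that trans_target unfolding trans_class_def by blast
    moreover have "j \<alpha> \<in> target" using j_val[OF b] val_target[OF b] by simp
    ultimately have "y \<in> target" "z \<in> target" "u \<in> target" using y z u by blast+
    then obtain c f g h where c: "c \<in> N" and v: "y = val (f, c)" "z = val (g, c)" "u = val (h, c)"
    proof -
      assume *: "\<And>c f g h. c \<in> N \<Longrightarrow> y = val (f, c) \<Longrightarrow> z = val (g, c) \<Longrightarrow> u = val (h, c) \<Longrightarrow> thesis"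
        and t: "y \<in> target" "z \<in> target" "u \<in> target"
      have "{y, z, u} \<prec> elts \<eta>" by (simp add: finite_lesspoll_infinite inf_eta)
      then obtain c k where "c \<in> N" "\<And>i. i \<in> {y, z, u} \<Longrightarrow> i = val (k i, c)"
        by (rule target_family[of _ "\<lambda>i. i"]) (use t in auto)
      then show thesis using * by blast
    qed
    have "ev c (\<lambda>w. f w \<in> elts \<alpha>)" "ev c (\<lambda>w. g w \<in> elts (f w))" "ev c (\<lambda>w. h w \<in> elts (g w))"
      using y z u v val_mem_iff[OF c] j_val[OF c] by simp_all
    then have "ev c (\<lambda>w. h w \<in> elts (f w))"
      by (rule ev_mono3[OF _ _ _ c]) (use Ord_mem[OF assms] Ord_trans in blast)
    then show ?thesis using v val_mem_iff[OF c] by simp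
  qed
  show ?thesis unfolding Ord_def trans_class_def using 1 2 by blast
qed

text \<open>Since \<alpha> has fewer than \<eta> members, \<open>val_set_of\<close> shows that the
  members of \<open>j \<alpha>\<close> are just the \<open>j \<beta>\<close> with \<beta> in
  \<alpha>; these are fixed by induction.\<close>

lemma j_fixes:
  assumes "\<alpha> \<in> elts \<eta>"
  shows "j \<alpha> = \<alpha>"
  using assms
proof (induction \<alpha> rule: wf_induct_rule[OF wf_mem])
  case (1 \<alpha>)
  obtain c where c: "c \<in> N" using N_ne by blast
  have "Ord \<eta>" using Card_eta by (simp add: Card_def)
  then have IH: "val (\<lambda>_. \<beta>, c) = \<beta>" if "\<beta> \<in> elts \<alpha>" for \<beta>
    using that 1 Ord_trans j_val[OF c] by fastforce
  have "j \<alpha> = val (\<lambda>w. set_of ((\<lambda>\<beta>. \<beta>) ` elts \<alpha>), c)" by (simp add: j_val[OF c])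
  also have "\<dots> = set_of ((\<lambda>\<beta>. val (\<lambda>_. \<beta>, c)) ` elts \<alpha>)"
    by (rule val_set_of[OF Card_mem_lesspoll[OF Card_eta 1(2)] c])
  also have "\<dots> = set_of (elts \<alpha>)" using IH by simp
  finally show ?case by simp
qed

text \<open>With all terms represented over one code, the pointwise sequence represents the given
  one: ordered pairs and short sets commute with \<open>val\<close>, and the indices, being below
  \<eta>, are fixed by \<open>j\<close>.\<close>

lemma closed_target: "closed_under_less_seqs target \<eta>"
  unfolding closed_under_less_seqs_def
proof (intro ballI allI impI)
  fix \<alpha> f assume \<alpha>: "\<alpha> \<in> elts \<eta>" and f: "f ` elts \<alpha> \<subseteq> target"
  have I: "elts \<alpha> \<prec> elts \<eta>" using Card_mem_lesspoll[OF Card_eta \<alpha>] .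
  obtain c h where c: "c \<in> N" and h: "\<And>\<xi>. \<xi> \<in> elts \<alpha> \<Longrightarrow> f \<xi> = val (h \<xi>, c)"
    by (rule target_family[OF I, of f]) (use f in auto)
  have pair: "val (\<lambda>w. set_of {a w, b w}, c) = set_of {val (a, c), val (b, c)}" for a b
  proof -
    obtain x y :: 'a where "x \<noteq> y" using exists_distinct by blast
    then show ?thesis
      using val_set_of[OF two_lesspoll[of x y] c, of "\<lambda>i. if i = x then a else b"] by simp
  qed
  have "val (\<lambda>w. kpair \<xi> (h \<xi> w), c) = kpair \<xi> (f \<xi>)" if \<xi>: "\<xi> \<in> elts \<alpha>" for \<xi>
  proof -
    have "\<xi> \<in> elts \<eta>" using \<xi> \<alpha> Card_eta Ord_trans unfolding Card_def by blast
    then have "val (\<lambda>_. \<xi>, c) = \<xi>" using j_fixes j_val[OF c] by simp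
    then show ?thesis
      using pair[of "\<lambda>_. \<xi>" "\<lambda>_. \<xi>"] h[OF \<xi>] by (simp add: kpair_def pair)
  qed
  then have "seq \<alpha> f = set_of ((\<lambda>\<xi>. val (\<lambda>w. kpair \<xi> (h \<xi> w), c)) ` elts \<alpha>)"
    by (simp add: seq_def)
  then show "seq \<alpha> f \<in> target"
    using val_set_of[OF I c, of "\<lambda>\<xi> w. kpair \<xi> (h \<xi> w)"] val_target[OF c] by metis
qed

text \<open>\<kappa> is the least ordinal moved. Were it in bijection \<open>g\<close> with some
  \<alpha> below it, any member of \<open>j \<kappa>\<close> could be pulled back along
  \<open>g\<close> to a member \<beta> of \<open>j \<alpha>\<close> = \<alpha>. It would then be
  \<open>j (g \<beta>)\<close> = \<open>g \<beta>\<close>, so \<open>j \<kappa>\<close> =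
  \<kappa>.\<close>

lemma critical_point_exists:
  assumes "Ord \<delta>" "j \<delta> \<noteq> \<delta>"
  obtains \<kappa> where "Card \<kappa>" "elts \<eta> \<subseteq> elts \<kappa>" "elts \<kappa> \<subseteq> elts \<delta>" "critical_point j \<kappa>"
proof -
  let ?S = "{\<alpha>. Ord \<alpha> \<and> j \<alpha> \<noteq> \<alpha>}"
  have "\<delta> \<in> ?S" using assms by simp
  then obtain \<kappa> where \<kappa>: "\<kappa> \<in> ?S" and "\<And>\<beta>. (\<beta>, \<kappa>) \<in> {(x, y). x \<in> elts y} \<Longrightarrow> \<beta> \<notin> ?S"
    by (rule wfE_min[OF wf_mem, of \<delta> ?S]) blast
  then have fixed: "j \<beta> = \<beta>" if "\<beta> \<in> elts \<kappa>" for \<beta> using that Ord_mem by auto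
  have crit: "critical_point j \<kappa>" using \<kappa> fixed by (simp add: critical_point_def)
  have "\<kappa> \<notin> elts \<eta>" using \<kappa> j_fixes by auto
  then have \<eta>: "elts \<eta> \<subseteq> elts \<kappa>"
    using Ord_mem_or_subset \<kappa> Card_eta unfolding Card_def by blast
  have \<delta>: "elts \<kappa> \<subseteq> elts \<delta>"
    using Ord_mem_or_subset[of \<delta> \<kappa>] fixed assms \<kappa> by blast
  have "Card \<kappa>"
    unfolding Card_def
  proof (intro conjI ballI notI)
    fix \<alpha> assume \<alpha>: "\<alpha> \<in> elts \<kappa>" and "elts \<alpha> \<approx> elts \<kappa>"
    then obtain g where g: "bij_betw g (elts \<alpha>) (elts \<kappa>)" unfolding eqpoll_def by blast
    have "elts (j \<kappa>) \<subseteq> elts \<kappa>"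
    proof
      fix x assume "x \<in> elts (j \<kappa>)"
      then obtain c f where c: "c \<in> N" and x: "x = val (f, c)" and e: "ev c (\<lambda>w. f w \<in> elts \<kappa>)"
        by (rule mem_jE)
      define h where "h = (\<lambda>w. inv_into (elts \<alpha>) g (f w))"
      have "ev c (\<lambda>w. h w \<in> elts \<alpha> \<and> g (h w) = f w)"
        unfolding h_def by (rule ev_mono[OF e c])
          (metis g bij_betw_def inv_into_into f_inv_into_f)
      then have h: "ev c (\<lambda>w. h w \<in> elts \<alpha>)" "ev c (\<lambda>w. g (h w) = f w)"
        by (simp_all add: ev_conj[OF c])
      define \<beta> where "\<beta> = val (h, c)"
      have \<beta>: "\<beta> \<in> elts \<alpha>"
        using h(1) fixed[OF \<alpha>] val_mem_iff[OF c, of h "\<lambda>_. \<alpha>"] j_val[OF c] by (simp add: \<beta>_def)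
      then have "\<beta> \<in> elts \<kappa>" using \<alpha> \<kappa> Ord_trans by blast
      then have "val (h, c) = val (\<lambda>_. \<beta>, c)"
        using fixed[of \<beta>] j_val[OF c, of \<beta>] by (simp add: \<beta>_def)
      then have "ev c (\<lambda>w. h w = \<beta>)" using val_eq_iff[OF c] by simp
      with h(2) have "ev c (\<lambda>w. f w = g \<beta>)" by (rule ev_mono2[OF _ _ c]) simp
      then have "x = j (g \<beta>)" using x val_eq_iff[OF c] j_val[OF c] by simp
      moreover have "g \<beta> \<in> elts \<kappa>" using g \<beta> unfolding bij_betw_def by blast
      ultimately show "x \<in> elts \<kappa>" using fixed by simp
    qed
    moreover have "elts \<kappa> \<subseteq> elts (j \<kappa>)" using fixed j_mem_iff by (metis subsetI)
    ultimately show False using \<kappa> extensionality by blast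
  qed (use \<kappa> in simp)
  then show ?thesis using that \<eta> \<delta> crit by blast
qed

text \<open>An element \<open>y\<close> of \<open>N\<close> is a nonstandard subset of \<delta>; the
  identity function over the code \<open>y\<close> represents it in the limit, and
  \<open>act_eq\<close> keeps distinct elements distinct.\<close>

lemma N_lepoll:
  assumes W: "\<And>x. x \<in> W \<Longrightarrow> elts x \<subseteq> elts \<delta>"
  shows "N \<lesssim> Pow (elts (j \<delta>))"
proof -
  let ?F = "\<lambda>y. elts (val (\<lambda>w. w, y))"
  have "inj_on ?F N"
  proof (rule inj_onI)
    fix y y' assume y: "y \<in> N" "y' \<in> N" and eq: "?F y = ?F y'"
    have "val (\<lambda>w. w, y) = val (\<lambda>w. w, y')" by (rule extensionality[OF eq])
    then have l: "lift (=) (\<lambda>w. w, y) (\<lambda>w. w, y')" by (rule val_inject) (use y in simp_all)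
    obtain d p q where d: "d \<in> N" "p ` W \<subseteq> W" "q ` W \<subseteq> W" "y = act p d" "y' = act q d"
      by (rule code2[OF y])
    have "ev d (\<lambda>w. p w = q w)" using l lift_iff[OF d(1-3), of "(=)" "\<lambda>w. w" "\<lambda>w. w"] d(4,5) by simp
    then show "y = y'" using act_eq[OF d(1-3)] d(4,5) by simp
  qed
  moreover have "?F y \<subseteq> elts (j \<delta>)" for y
  proof
    fix z assume "z \<in> ?F y"
    then obtain d q f where d: "d \<in> N" "q ` W \<subseteq> W" "z = val (f, d)" "ev d (\<lambda>w. f w \<in> elts (q w))"
      by (rule elts_valE)
    have "ev d (\<lambda>w. f w \<in> elts \<delta>)" by (rule ev_mono[OF d(4) d(1)]) (use W d(2) in blast)
    then show "z \<in> elts (j \<delta>)" using d val_mem_iff[OF d(1)] j_val[OF d(1)] by simp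
  qed
  ultimately show ?thesis unfolding lepoll_def by (intro exI[of _ ?F]) auto
qed

end

section \<open>Elementary extensions of structures with names for all relations and functions\<close>

text \<open>Each symbol is its own interpretation: a relation symbol is a subset of
  \<open>W\<close>, a function symbol is the graph of a function. This keeps the language
  small.\<close>

definition full_lang :: "'a::zfc \<Rightarrow> 'a lang" where
  "full_lang W = \<lparr>relsyms = {r. elts r \<subseteq> elts W}, funsyms = {seq W p | p. p ` elts W \<subseteq> elts W},
     rel_ar = (\<lambda>_. 1), fun_ar = (\<lambda>_. 1)\<rparr>"

definition full_struct :: "'a::zfc \<Rightarrow> 'a struct" where
  "full_struct W = \<lparr>univ = elts W, rel_of = (\<lambda>r xs. hd xs \<in> elts r),
     fun_of = (\<lambda>f xs. THE y. kpair (hd xs) y \<in> elts f)\<rparr>"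

lemma language_full_lang: "language (full_lang W)"
  by (simp add: language_def full_lang_def small_seqs)

lemma structure_full_struct: "elts W \<noteq> {} \<Longrightarrow> structure (full_lang W) (full_struct W)"
  unfolding structure_def full_lang_def full_struct_def
  by (auto simp: length_Suc_conv seq_apply image_subset_iff)

text \<open>Conjunctions are indexed by sets of the universe, so a binary one needs two distinct
  sets as indices; which ones is immaterial.\<close>

definition Iff :: "'a::zfc fm \<Rightarrow> 'a fm \<Rightarrow> 'a fm" where
  "Iff \<phi> \<psi> = (let (x, y) = (SOME (x, y). x \<noteq> y);
      conj = (\<lambda>\<phi> \<psi>. Conj {x, y} (\<lambda>i. if i = x then \<phi> else \<psi>))
    in conj (Neg (conj \<phi> (Neg \<psi>))) (Neg (conj \<psi> (Neg \<phi>))))"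

lemma Iff_eq:
  "\<exists>x y :: 'a::zfc. x \<noteq> y \<and> (\<forall>\<phi> \<psi>. Iff \<phi> \<psi> =
    Conj {x, y} (\<lambda>i. if i = x then Neg (Conj {x, y} (\<lambda>i. if i = x then \<phi> else Neg \<psi>))
                        else Neg (Conj {x, y} (\<lambda>i. if i = x then \<psi> else Neg \<phi>))))"
proof -
  obtain x y :: 'a where xy: "(SOME (x, y). (x::'a) \<noteq> y) = (x, y)" by fastforce
  have "case (SOME (x, y). (x::'a) \<noteq> y) of (x, y) \<Rightarrow> x \<noteq> y"
    by (rule someI_ex) (use exists_distinct in auto)
  then have "x \<noteq> y" using xy by simp
  then show ?thesis by (intro exI[of _ x] exI[of _ y]) (simp add: Iff_def xy Let_def)
qed

lemma sat_Iff: "sat M (Iff \<phi> \<psi>) a \<longleftrightarrow> (sat M \<phi> a \<longleftrightarrow> sat M \<psi> a)"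
  for M :: "'a::zfc struct"
proof -
  obtain x y :: 'a where xy: "x \<noteq> y" and "\<And>\<phi> \<psi>. Iff \<phi> \<psi> =
    Conj {x, y} (\<lambda>i. if i = x then Neg (Conj {x, y} (\<lambda>i. if i = x then \<phi> else Neg \<psi>))
                        else Neg (Conj {x, y} (\<lambda>i. if i = x then \<psi> else Neg \<phi>)))"
    using Iff_eq by blast
  then show ?thesis using xy by auto
qed

lemma wf_Iff: "infinite (elts \<mu>) \<Longrightarrow> wf_fm \<mu> \<nu> \<tau> (Iff \<phi> \<psi>) \<longleftrightarrow> wf_fm \<mu> \<nu> \<tau> \<phi> \<and> wf_fm \<mu> \<nu> \<tau> \<psi>"
  for \<mu> :: "'a::zfc"
proof -
  assume inf: "infinite (elts \<mu>)"
  obtain x y :: 'a where xy: "x \<noteq> y" and "\<And>\<phi> \<psi>. Iff \<phi> \<psi> =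
    Conj {x, y} (\<lambda>i. if i = x then Neg (Conj {x, y} (\<lambda>i. if i = x then \<phi> else Neg \<psi>))
                        else Neg (Conj {x, y} (\<lambda>i. if i = x then \<psi> else Neg \<phi>)))"
    using Iff_eq by blast
  then show ?thesis using xy finite_lesspoll_infinite[OF inf, of "{x, y}"] by auto
qed

text \<open>\<open>coding\<close> asks for projections \<open>p i\<close> that jointly decode every
  family of elements of \<open>W\<close> indexed by \<open>I\<close>. It is a statement about
  \<open>W\<close> alone, which elementarity carries over to \<open>S\<close>.\<close>

locale full_extension =
  fixes \<eta> W :: "'a::zfc" and S :: "'a struct"
  assumes Card_eta: "Card \<eta>" and unc: "uncountable (elts \<eta>)"
    and W_ne: "elts W \<noteq> {}"
    and coding: "\<And>I :: 'a set. I \<prec> elts \<eta> \<Longrightarrow> \<exists>p. (\<forall>i\<in>I. p i ` elts W \<subseteq> elts W) \<and>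
      (\<forall>a. a ` I \<subseteq> elts W \<longrightarrow> (\<exists>c\<in>elts W. \<forall>i\<in>I. p i c = a i))"
    and struct: "structure (full_lang W) S"
    and elem: "elem_substructure (L_inf \<eta> \<eta>) (full_lang W) (full_struct W) S"
begin

abbreviation ext_rel :: "('a \<Rightarrow> bool) \<Rightarrow> 'a tm \<Rightarrow> 'a fm" where
  "ext_rel P t \<equiv> Rel (set_of {w \<in> elts W. P w}) [t]"

abbreviation ext_fun :: "('a \<Rightarrow> 'a) \<Rightarrow> 'a tm \<Rightarrow> 'a tm" where
  "ext_fun p t \<equiv> Fun (seq W p) [t]"

section \<open>Transfer from the full structure to its extension\<close>

definition ev :: "'a \<Rightarrow> ('a \<Rightarrow> bool) \<Rightarrow> bool" where
  "ev c P \<longleftrightarrow> rel_of S (set_of {w \<in> elts W. P w}) [c]"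

definition act :: "('a \<Rightarrow> 'a) \<Rightarrow> 'a \<Rightarrow> 'a" where
  "act p c = fun_of S (seq W p) [c]"

lemma inf_eta: "infinite (elts \<eta>)"
  using unc countable_finite by blast

lemma elts_ext [simp]: "elts (set_of {w \<in> elts W. P w}) = {w \<in> elts W. P w}"
  by (rule elts_set_of, rule small_subset[of "elts W"]) auto

lemma wf_ext_rel [simp]: "wf_fm \<mu> \<nu> (full_lang W) (ext_rel P t) \<longleftrightarrow> wf_tm (full_lang W) t"
  by (auto simp: full_lang_def)

lemma wf_ext_fun [simp]:
  "p ` elts W \<subseteq> elts W \<Longrightarrow> wf_tm (full_lang W) (ext_fun p t) \<longleftrightarrow> wf_tm (full_lang W) t"
  by (auto simp: full_lang_def)

lemma sat_ext_rel: "sat S (ext_rel P t) a \<longleftrightarrow> ev (eval_tm S a t) P"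
  by (simp add: ev_def)

lemma eval_ext_fun: "eval_tm S a (ext_fun p t) = act p (eval_tm S a t)"
  by (simp add: act_def)

lemma sat_full_ext_rel:
  "eval_tm (full_struct W) a t \<in> elts W \<Longrightarrow>
    sat (full_struct W) (ext_rel P t) a \<longleftrightarrow> P (eval_tm (full_struct W) a t)"
  by (simp add: full_struct_def)

lemma eval_full_ext_fun:
  "eval_tm (full_struct W) a t \<in> elts W \<Longrightarrow>
    eval_tm (full_struct W) a (ext_fun p t) = p (eval_tm (full_struct W) a t)"
  by (simp add: full_struct_def seq_apply)

text \<open>Named relations and functions stay folded, so that only the rules in
  \<open>eval_simps\<close> evaluate them.\<close>

declare sat.simps(2) [simp del] eval_tm.simps(2) [simp del]
  wf_tm.simps(2) [simp del] wf_fm.simps(2) [simp del]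

lemmas eval_simps = sat_ext_rel eval_ext_fun sat_full_ext_rel eval_full_ext_fun

text \<open>Elementarity speaks only about assignments into \<open>W\<close>, whereas
  \<open>b\<close> may take new values in \<open>S\<close>. So the universal closure over
  \<open>X\<close> is transferred at the constant assignment \<open>w\<close> and then instantiated
  in \<open>S\<close>.\<close>

lemma transfer:
  assumes wf: "wf_fm \<eta> \<eta> (full_lang W) \<phi>" and X: "X \<prec> elts \<eta>" and w: "w \<in> elts W"
    and M: "\<And>b. range b \<subseteq> elts W \<Longrightarrow> sat (full_struct W) \<phi> b"
    and b: "\<And>x. x \<in> X \<Longrightarrow> b x \<in> univ S" "\<And>x. x \<notin> X \<Longrightarrow> b x = w"
  shows "sat S \<phi> b"
proof -
  have "All X \<phi> \<in> L_inf \<eta> \<eta> (full_lang W)" using wf X by (simp add: L_inf_def)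
  moreover have univ: "univ (full_struct W) = elts W" by (simp add: full_struct_def)
  then have "range (\<lambda>_. w) \<subseteq> univ (full_struct W)" using w by auto
  ultimately have "sat (full_struct W) (All X \<phi>) (\<lambda>_. w) \<longleftrightarrow> sat S (All X \<phi>) (\<lambda>_. w)"
    using elem unfolding elem_substructure_def by (metis (no_types))
  moreover have "sat (full_struct W) (All X \<phi>) (\<lambda>_. w)"
    unfolding sat.simps
  proof (intro allI impI M)
    fix b assume "reassign (full_struct W) X (\<lambda>_. w) b"
    then show "range b \<subseteq> elts W" using w unfolding reassign_def univ by (auto split: if_splits)
  qed
  ultimately have "sat S (All X \<phi>) (\<lambda>_. w)" by blast
  moreover have "reassign S X (\<lambda>_. w) b" using b by (simp add: reassign_def)
  ultimately show ?thesis by simp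
qed

definition base :: 'a where
  "base = (SOME w. w \<in> elts W)"

lemma base: "base \<in> elts W"
  using W_ne unfolding base_def by (simp add: some_in_eq)

text \<open>The name of the single free variable used below is irrelevant; \<open>base\<close> serves as one.\<close>

definition assign :: "'a \<Rightarrow> 'a \<Rightarrow> 'a" where
  "assign c = (\<lambda>_. base)(base := c)"

lemma assign_base [simp]: "assign c base = c"
  by (simp add: assign_def)

lemma transfer1:
  assumes "wf_fm \<eta> \<eta> (full_lang W) \<phi>" "\<And>b. range b \<subseteq> elts W \<Longrightarrow> sat (full_struct W) \<phi> b"
    and "c \<in> univ S"
  shows "sat S \<phi> (assign c)"
proof (rule transfer[of \<phi> "{base}" base])
  show "{base} \<prec> elts \<eta>" by (simp add: finite_lesspoll_infinite inf_eta)
qed (use assms base in \<open>auto simp: assign_def\<close>)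

text \<open>In the full structure \<phi> is equivalent to the relation symbol naming the extension
  of \<open>P\<close>; this equivalence is transferred. Most axioms of \<open>ultra_system\<close>
  are instances.\<close>

lemma comprehension:
  assumes "wf_fm \<eta> \<eta> (full_lang W) \<phi>" "c \<in> univ S"
    and P: "\<And>b. range b \<subseteq> elts W \<Longrightarrow> sat (full_struct W) \<phi> b \<longleftrightarrow> P (b base)"
  shows "sat S \<phi> (assign c) \<longleftrightarrow> ev c P"
proof -
  have "sat S (Iff \<phi> (ext_rel P (Var base))) (assign c)"
  proof (rule transfer1)
    fix b :: "'a \<Rightarrow> 'a" assume b: "range b \<subseteq> elts W"
    then have "b base \<in> elts W" by auto
    then show "sat (full_struct W) (Iff \<phi> (ext_rel P (Var base))) b"
      using P[OF b] by (simp add: sat_Iff sat_full_ext_rel)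
  qed (use assms inf_eta in \<open>simp_all add: wf_Iff\<close>)
  then show ?thesis by (simp add: sat_Iff sat_ext_rel)
qed

sublocale ultra_system \<eta> "elts W" "univ S" ev act
proof
  show "Card \<eta>" "uncountable (elts \<eta>)" using Card_eta unc .
  show "small (elts W)" by simp
  show "small (univ S)" "univ S \<noteq> {}" using struct by (simp_all add: structure_def)
  have in_W: "b x \<in> elts W" if "range b \<subseteq> elts W" for b :: "'a \<Rightarrow> 'a" and x using that by auto
  have in_W': "p x \<in> elts W" if "p ` elts W \<subseteq> elts W" "x \<in> elts W" for p :: "'a \<Rightarrow> 'a" and x
    using that by auto
  show "ev c P = ev c Q" if "\<And>w. w \<in> elts W \<Longrightarrow> P w = Q w" for c P Q
    using that unfolding ev_def by (metis (mono_tags, lifting) Collect_cong)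
  show "ev c (\<lambda>w. \<not> P w) \<longleftrightarrow> \<not> ev c P" if "c \<in> univ S" for c P
    using comprehension[of "Neg (ext_rel P (Var base))" c "\<lambda>w. \<not> P w"] that
    by (simp add: eval_simps in_W)
  show "ev c (\<lambda>w. \<forall>i\<in>I. R i w) \<longleftrightarrow> (\<forall>i\<in>I. ev c (R i))"
    if "c \<in> univ S" "I \<prec> elts \<eta>" for c and I :: "'a set" and R
    using comprehension[of "Conj I (\<lambda>i. ext_rel (R i) (Var base))" c "\<lambda>w. \<forall>i\<in>I. R i w"] that
    by (simp add: eval_simps in_W)
  show "act p c \<in> univ S" if c: "c \<in> univ S" and p: "p ` elts W \<subseteq> elts W" for c p
  proof -
    have "seq W p \<in> funsyms (full_lang W)" "fun_ar (full_lang W) (seq W p) = 1"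
      using p by (auto simp: full_lang_def)
    moreover have "[c] \<in> lists (univ S)" using c by simp
    ultimately show ?thesis
      using struct unfolding structure_def act_def by (metis One_nat_def length_Cons list.size(3))
  qed
  show "ev (act p c) P \<longleftrightarrow> ev c (\<lambda>w. P (p w))"
    if "c \<in> univ S" "p ` elts W \<subseteq> elts W" for c p P
    using comprehension[of "ext_rel P (ext_fun p (Var base))" c "\<lambda>w. P (p w)"] that
    by (simp add: eval_simps in_W in_W')
  show "act p c = act q c \<longleftrightarrow> ev c (\<lambda>w. p w = q w)"
    if "c \<in> univ S" "p ` elts W \<subseteq> elts W" "q ` elts W \<subseteq> elts W" for c p q
    using comprehension[of "Eq (ext_fun p (Var base)) (ext_fun q (Var base))" c "\<lambda>w. p w = q w"] that
    by (simp add: eval_simps in_W in_W')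
  show "act p (act q c) = act (\<lambda>w. p (q w)) c"
    if "c \<in> univ S" "p ` elts W \<subseteq> elts W" "q ` elts W \<subseteq> elts W" for c p q
  proof -
    have "(\<lambda>w. p (q w)) ` elts W \<subseteq> elts W" using that by auto
    then show ?thesis
      using transfer1[of "Eq (ext_fun p (ext_fun q (Var base))) (ext_fun (\<lambda>w. p (q w)) (Var base))" c]
        that by (simp add: eval_simps in_W in_W')
  qed
  show "act (\<lambda>w. w) c = c" if "c \<in> univ S" for c
    using transfer1[of "Eq (ext_fun (\<lambda>w. w) (Var base)) (Var base)" c] that
    by (simp add: eval_simps in_W)
  show "\<exists>c\<in>univ S. \<exists>p. \<forall>i\<in>I. p i ` elts W \<subseteq> elts W \<and> act (p i) c = a i"
    if I: "I \<prec> elts \<eta>" and a: "\<And>i. i \<in> I \<Longrightarrow> a i \<in> univ S" for I :: "'a set" and a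
  proof -
    obtain p where p: "\<And>i. i \<in> I \<Longrightarrow> p i ` elts W \<subseteq> elts W"
      and p_code: "\<And>a. a ` I \<subseteq> elts W \<Longrightarrow> \<exists>c\<in>elts W. \<forall>i\<in>I. p i c = a i"
      using coding[OF I] by blast
    have "small I" using I by (meson lesspoll_imp_lepoll small_elts small_lepoll)
    then obtain v where v: "v \<notin> I" using exists_notin_small by blast
    \<comment> \<open>The formula says that the values of the variables in \<open>I\<close> have a
      common code. Each index serves as its own variable, so \<open>v\<close> is taken outside
      \<open>I\<close>.\<close>
    let ?\<phi> = "Ex {v} (Conj I (\<lambda>i. Eq (ext_fun (p i) (Var v)) (Var i)))"
    define b where "b = (\<lambda>i. if i \<in> I then a i else base)"
    have "{v} \<prec> elts \<eta>" by (simp add: finite_lesspoll_infinite inf_eta)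
    have "sat S ?\<phi> b"
    proof (rule transfer[OF _ I base])
      show "wf_fm \<eta> \<eta> (full_lang W) ?\<phi>" using I p \<open>{v} \<prec> elts \<eta>\<close> by simp
      fix b :: "'a \<Rightarrow> 'a" assume b: "range b \<subseteq> elts W"
      then obtain c where c: "c \<in> elts W" "\<forall>i\<in>I. p i c = b i" using p_code[of b] by blast
      have "reassign (full_struct W) {v} b (b(v := c))"
        using c(1) by (simp add: reassign_def full_struct_def)
      moreover have "sat (full_struct W) (Conj I (\<lambda>i. Eq (ext_fun (p i) (Var v)) (Var i))) (b(v := c))"
        using c v by (auto simp: eval_full_ext_fun)
      ultimately show "sat (full_struct W) ?\<phi> b" by auto
    qed (use a in \<open>auto simp: b_def\<close>)
    then obtain b' where b': "reassign S {v} b b'" "\<forall>i\<in>I. act (p i) (b' v) = b' i"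
      by (auto simp: eval_ext_fun)
    have "b' i = a i" if "i \<in> I" for i
    proof -
      have "b' i = b i" using b'(1) that v unfolding reassign_def by (metis singletonD)
      then show ?thesis using that by (simp add: b_def)
    qed
    moreover have "b' v \<in> univ S" using b'(1) unfolding reassign_def by (metis insertI1)
    ultimately show ?thesis using p b'(2) by metis
  qed
qed

end

text \<open>An injection \<open>k\<close> of the square of \<delta> into \<delta> turns a family of
  at most \<delta> subsets of \<delta> into one subset, and \<open>p i\<close> extracts the slice at
  \<open>e i\<close>.\<close>

lemma Pow_coding:
  fixes \<delta> :: "'a::zfc" and I :: "'a set"
  assumes inf: "infinite (elts \<delta>)" and I: "I \<lesssim> elts \<delta>" and W: "elts W = {x. elts x \<subseteq> elts \<delta>}"
  shows "\<exists>p. (\<forall>i\<in>I. p i ` elts W \<subseteq> elts W) \<and>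
      (\<forall>a. a ` I \<subseteq> elts W \<longrightarrow> (\<exists>c\<in>elts W. \<forall>i\<in>I. p i c = a i))"
proof -
  obtain e where e: "inj_on e I" "e ` I \<subseteq> elts \<delta>" using I unfolding lepoll_def by blast
  obtain k where k: "inj_on k (elts \<delta> \<times> elts \<delta>)" "k ` (elts \<delta> \<times> elts \<delta>) \<subseteq> elts \<delta>"
    using card_of_ordIso[THEN iffD2, OF card_of_Times_same_infinite[OF inf]]
    unfolding bij_betw_def by blast
  have sub: "elts (set_of B) = B" if "B \<subseteq> elts \<delta>" for B
    using elts_set_of[OF small_subset[OF small_elts that]] .
  define p where "p = (\<lambda>i y. set_of {x \<in> elts \<delta>. k (e i, x) \<in> elts y})"
  have elts_p: "elts (p i y) = {x \<in> elts \<delta>. k (e i, x) \<in> elts y}" for i y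
    unfolding p_def by (rule sub) auto
  have "\<exists>c\<in>elts W. \<forall>i\<in>I. p i c = a i" if a: "a ` I \<subseteq> elts W" for a
  proof -
    define C where "C = {k (e i, x) | i x. i \<in> I \<and> x \<in> elts (a i)}"
    have a': "elts (a i) \<subseteq> elts \<delta>" if "i \<in> I" for i using a that W by auto
    have "C \<subseteq> elts \<delta>" using k(2) e(2) a' unfolding C_def by blast
    then have C: "elts (set_of C) = C" by (rule sub)
    have "p i (set_of C) = a i" if i: "i \<in> I" for i
    proof (rule extensionality)
      show "elts (p i (set_of C)) = elts (a i)"
        unfolding elts_p C
      proof (intro equalityI subsetI)
        fix x assume "x \<in> {x \<in> elts \<delta>. k (e i, x) \<in> C}"
        then obtain i' x' where *: "x \<in> elts \<delta>" "i' \<in> I" "x' \<in> elts (a i')" "k (e i, x) = k (e i', x')"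
          unfolding C_def by blast
        then have "(e i, x) \<in> elts \<delta> \<times> elts \<delta>" "(e i', x') \<in> elts \<delta> \<times> elts \<delta>" using i e(2) a' by blast+
        then have "e i = e i'" "x = x'" using * k(1) by (auto dest: inj_onD)
        then show "x \<in> elts (a i)" using * i e(1) by (auto dest: inj_onD)
      next
        fix x assume "x \<in> elts (a i)"
        then show "x \<in> {x \<in> elts \<delta>. k (e i, x) \<in> C}" using a' i unfolding C_def by blast
      qed
    qed
    moreover have "set_of C \<in> elts W" using C \<open>C \<subseteq> elts \<delta>\<close> by (simp add: W)
    ultimately show ?thesis by blast
  qed
  moreover have "\<forall>i\<in>I. p i ` elts W \<subseteq> elts W" using W elts_p by auto
  ultimately show ?thesis by blast
qed

section \<open>Tall cardinals from the Loewenheim-Skolem-Tarski property\<close>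

lemma SULST_embedding:
  fixes \<eta> \<delta> \<theta> :: "'a::zfc"
  assumes \<eta>: "Card \<eta>" "uncountable (elts \<eta>)" and \<delta>: "Card \<delta>" "elts \<eta> \<subseteq> elts \<delta>"
    and SULST: "SULST_property (L_inf \<eta> \<eta>) \<delta>"
    and \<theta>: "Ord \<theta>" "elts \<delta> \<subseteq> elts \<theta>"
  shows "\<exists>\<kappa> j M. Card \<kappa> \<and> elts \<eta> \<subseteq> elts \<kappa> \<and> elts \<kappa> \<subseteq> elts \<delta> \<and> critical_point j \<kappa> \<and>
    trans_class M \<and> elem_embedding j M \<and> closed_under_less_seqs M \<eta> \<and> \<theta> \<in> elts (j \<delta>) \<and> Ord (j \<delta>)"
proof -
  define W where "W = set_of {x. elts x \<subseteq> elts \<delta>}"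
  have W: "elts W = {x. elts x \<subseteq> elts \<delta>}" by (simp add: W_def)
  define P where "P = {x. elts x \<subseteq> elts \<theta>}"
  have P: "small P" "P \<approx> Pow (elts \<theta>)" by (simp_all add: P_def Pow_eqpoll)
  obtain \<gamma> :: 'a where \<gamma>: "Card \<gamma>" "elts \<gamma> \<approx> elts W"
    by (rule Card_eqpoll_exists[OF small_elts[of W]]) blast
  \<comment> \<open>Taking the double power set of \<theta> puts \<gamma>' strictly above the size
    of \<open>P\<close>, and so above \<gamma>, since \<open>W\<close> is included in
    \<open>P\<close>.\<close>
  obtain \<gamma>' :: 'a where \<gamma>': "Card \<gamma>'" "elts \<gamma>' \<approx> {x. elts x \<subseteq> P}"
    by (rule Card_eqpoll_exists[OF small_Pow[OF P(1)]]) blast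
  have P\<gamma>': "P \<prec> elts \<gamma>'"
  proof -
    have "Pow P \<lesssim> elts \<gamma>'"
      using eqpoll_sym[OF eqpoll_trans[OF \<gamma>'(2) Pow_eqpoll[OF P(1)]]] eqpoll_imp_lepoll by blast
    then show ?thesis using lesspoll_trans2[OF lesspoll_Pow_self] by blast
  qed
  have "elts \<delta> \<subseteq> elts W" using Ord_trans \<delta>(1) unfolding W Card_def by blast
  then have "elts \<delta> \<lesssim> elts \<gamma>"
    using subset_imp_lepoll eqpoll_imp_lepoll[OF eqpoll_sym[OF \<gamma>(2)]] lepoll_trans by blast
  then have "elts \<delta> \<subseteq> elts \<gamma>" using Card_lepoll_subset \<delta>(1) \<gamma>(1) by blast
  moreover have "\<gamma> \<in> elts \<gamma>'"
  proof (rule Card_lesspoll_mem[OF \<gamma>(1) \<gamma>'(1)])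
    have "elts W \<subseteq> P" using \<theta>(2) by (auto simp: W P_def)
    then have "elts \<gamma> \<lesssim> P" using \<gamma>(2) subset_imp_lepoll eqpoll_imp_lepoll lepoll_trans by blast
    then show "elts \<gamma> \<prec> elts \<gamma>'" using P\<gamma>' lesspoll_trans1 by blast
  qed
  moreover have inf: "infinite (elts \<delta>)"
    using \<eta>(2) \<delta>(2) countable_finite finite_subset by blast
  then have W_ne: "elts W \<noteq> {}" using \<open>elts \<delta> \<subseteq> elts W\<close> by auto
  moreover have "univ (full_struct W) \<approx> elts \<gamma>"
    using eqpoll_sym[OF \<gamma>(2)] by (simp add: full_struct_def)
  ultimately obtain S where S: "structure (full_lang W) S" "elts \<gamma>' \<lesssim> univ S"
    "elem_substructure (L_inf \<eta> \<eta>) (full_lang W) (full_struct W) S"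
    using SULST language_full_lang[of W] structure_full_struct[OF W_ne] \<gamma>(1) \<gamma>'(1)
    unfolding SULST_property_def by blast
  have "I \<lesssim> elts \<delta>" if "I \<prec> elts \<eta>" for I :: "'a set"
    using that \<delta>(2) lesspoll_imp_lepoll subset_imp_lepoll lepoll_trans by blast
  then interpret full_extension \<eta> W S
    using \<eta> W_ne S Pow_coding[OF inf _ W] by unfold_locales auto
  have \<delta>Ord: "Ord \<delta>" using \<delta>(1) by (simp add: Card_def)
  then have jOrd: "Ord (j \<delta>)" by (rule Ord_j)
  \<comment> \<open>Otherwise \<open>j \<delta>\<close> would be included in \<theta>, and
    \<open>N_lepoll\<close> would bound the extension by the power set of \<theta>.\<close>
  have "\<theta> \<in> elts (j \<delta>)"
  proof (rule ccontr)
    assume "\<theta> \<notin> elts (j \<delta>)"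
    then have "elts (j \<delta>) \<subseteq> elts \<theta>" using Ord_mem_or_subset[OF \<theta>(1) jOrd] by blast
    then have "Pow (elts (j \<delta>)) \<lesssim> Pow (elts \<theta>)" by (intro subset_imp_lepoll Pow_mono)
    moreover have "univ S \<lesssim> Pow (elts (j \<delta>))" by (rule N_lepoll) (simp add: W)
    moreover have "Pow (elts \<theta>) \<lesssim> P" using eqpoll_imp_lepoll[OF eqpoll_sym[OF P(2)]] .
    ultimately have "elts \<gamma>' \<lesssim> P" using S(2) lepoll_trans by meson
    then have "P \<prec> P" using P\<gamma>' lesspoll_trans2 by blast
    then show False by (simp add: lesspoll_def)
  qed
  \<comment> \<open>If \<open>j \<delta>\<close> were \<delta>, then \<theta> would belong to
    \<delta>, a subset of \<theta>.\<close>
  moreover from this have "j \<delta> \<noteq> \<delta>" using \<theta>(2) mem_irrefl[of \<theta>] by auto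
  then obtain \<kappa> where "Card \<kappa>" "elts \<eta> \<subseteq> elts \<kappa>" "elts \<kappa> \<subseteq> elts \<delta>" "critical_point j \<kappa>"
    using critical_point_exists[OF \<delta>Ord] by blast
  ultimately show ?thesis
    using trans_target elem_embedding_j closed_target jOrd by blast
qed

text \<open>Below \<open>\<eta>\<close> the property fails, since a structure with fewer than \<open>\<eta>\<close> elements
  can be enumerated in a single formula and therefore has no proper elementary extension.\<close>

lemma SULST_property_ge:
  fixes \<eta> \<delta> :: "'a::zfc"
  assumes \<eta>: "Card \<eta>" "infinite (elts \<eta>)" and \<delta>: "Card \<delta>"
    and SULST: "SULST_property (L_inf \<eta> \<eta>) \<delta>"
  shows "elts \<eta> \<subseteq> elts \<delta>"
proof (rule ccontr)
  assume "\<not> ?thesis"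
  then have "\<delta> \<in> elts \<eta>" using Ord_mem_or_subset \<eta>(1) \<delta> unfolding Card_def by blast
  then have \<delta>\<eta>: "elts \<delta> \<prec> elts \<eta>" using Card_mem_lesspoll[OF \<eta>(1)] by blast
  \<comment> \<open>The domain of a structure is nonempty, so a singleton replaces \<delta> when
    \<delta> is zero.\<close>
  define A where "A = (if elts \<delta> = {} then {\<eta>} else elts \<delta>)"
  have A: "small A" "A \<noteq> {}" "A \<prec> elts \<eta>" "elts \<delta> \<subseteq> A"
    using \<delta>\<eta> finite_lesspoll_infinite[OF \<eta>(2), of "{\<eta>}"] by (auto simp: A_def)
  obtain \<gamma> :: 'a where \<gamma>: "Card \<gamma>" "elts \<gamma> \<approx> A" by (rule Card_eqpoll_exists[OF A(1)]) blast
  have "elts \<delta> \<subseteq> elts \<gamma>"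
    using Card_lepoll_subset[OF \<delta> \<gamma>(1)] subset_imp_lepoll[OF A(4)]
      eqpoll_imp_lepoll[OF eqpoll_sym[OF \<gamma>(2)]] lepoll_trans by blast
  \<comment> \<open>Hence \<eta> itself can be the target cardinality, which forces at least \<eta>
    elements in the extension.\<close>
  moreover have "\<gamma> \<in> elts \<eta>"
    using Card_lesspoll_mem[OF \<gamma>(1) \<eta>(1)] eq_lesspoll_trans[OF \<gamma>(2) A(3)] by blast
  moreover
  define \<tau> :: "'a lang" where "\<tau> = \<lparr>relsyms = {}, funsyms = {}, rel_ar = (\<lambda>_. 0), fun_ar = (\<lambda>_. 0)\<rparr>"
  define M where "M = \<lparr>univ = A, rel_of = (\<lambda>_ _. True), fun_of = (\<lambda>_ _. \<eta>)\<rparr>"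
  have "small ({} :: 'a set)" by (rule small_subset[OF A(1)]) simp
  then have "language \<tau>" "structure \<tau> M" using A by (simp_all add: language_def structure_def \<tau>_def M_def)
  moreover have "univ M \<approx> elts \<gamma>" using eqpoll_sym[OF \<gamma>(2)] by (simp add: M_def)
  ultimately obtain N where N: "elts \<eta> \<lesssim> univ N" "elem_substructure (L_inf \<eta> \<eta>) \<tau> M N"
    using SULST \<gamma>(1) \<eta>(1) unfolding SULST_property_def by blast
  obtain v where v: "v \<notin> A" using exists_notin_small[OF A(1)] by blast
  \<comment> \<open>The elements of \<open>A\<close> name themselves as variables, and the
    assignment \<open>a\<close> below fixes each of them; \<open>v\<close> is fresh. The formula
    says that nothing else exists.\<close>
  let ?\<phi> = "All {v} (Disj A (\<lambda>i. Eq (Var v) (Var i)))"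
  obtain a0 where a0: "a0 \<in> A" using A(2) by blast
  define a where "a = (\<lambda>i. if i \<in> A then i else a0)"
  have "{v} \<prec> elts \<eta>" by (simp add: finite_lesspoll_infinite \<eta>(2))
  then have "?\<phi> \<in> L_inf \<eta> \<eta> \<tau>" using A(3) by (simp add: L_inf_def)
  moreover have "range a \<subseteq> univ M" using a0 by (auto simp: a_def M_def)
  moreover have "sat M ?\<phi> a"
  proof -
    have "\<exists>i\<in>A. b v = b i" if b: "reassign M {v} a b" for b
    proof -
      have "b v \<in> A" using b unfolding reassign_def M_def by (metis insertI1 select_convs(1))
      moreover from this have "b (b v) = b v"
        using b v unfolding reassign_def a_def by (metis singletonD)
      ultimately show ?thesis by metis
    qed
    then show ?thesis by simp
  qed
  ultimately have sat: "sat N ?\<phi> a" using N(2) unfolding elem_substructure_def by blast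
  have "univ N \<subseteq> A"
  proof
    fix y assume y: "y \<in> univ N"
    then have "reassign N {v} a (a(v := y))" by (simp add: reassign_def)
    then obtain i where "i \<in> A" "(a(v := y)) v = (a(v := y)) i" using sat by auto
    then show "y \<in> A" using v by (auto simp: a_def split: if_splits)
  qed
  then have "elts \<eta> \<lesssim> A" using N(1) subset_imp_lepoll lepoll_trans by blast
  then have "A \<prec> A" using A(3) lesspoll_trans2 by blast
  then show False by (simp add: lesspoll_def)
qed

theorem theorem8p16:
  fixes \<eta> \<delta> :: "'a::zfc"
  assumes "regular \<eta>" and "uncountable (elts \<eta>)"
    and "is_SULST (L_inf \<eta> \<eta>) \<delta>"
  shows "\<exists>\<kappa>. Card \<kappa> \<and> elts \<eta> \<subseteq> elts \<kappa> \<and> elts \<kappa> \<subseteq> elts \<delta> \<and> tall_pushing_up \<kappa> \<delta> \<eta>"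
proof (rule ccontr)
  assume none: "\<not> ?thesis"
  have \<eta>: "Card \<eta>" "infinite (elts \<eta>)" using assms(1) by (simp_all add: regular_def)
  have \<delta>: "Card \<delta>" and SULST: "SULST_property (L_inf \<eta> \<eta>) \<delta>"
    using assms(3) by (simp_all add: is_SULST_def)
  have \<eta>\<delta>: "elts \<eta> \<subseteq> elts \<delta>" using SULST_property_ge[OF \<eta> \<delta> SULST] .
  let ?K = "{\<kappa>. Card \<kappa> \<and> elts \<eta> \<subseteq> elts \<kappa> \<and> elts \<kappa> \<subseteq> elts \<delta>}"
  let ?emb = "\<lambda>\<kappa> \<theta>. \<exists>j M. trans_class M \<and> elem_embedding j M \<and> critical_point j \<kappa> \<and>
           closed_under_less_seqs M \<eta> \<and> \<theta> \<in> elts (j \<delta>)"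
  have "\<forall>\<kappa>\<in>?K. \<exists>\<theta>. Ord \<theta> \<and> \<not> ?emb \<kappa> \<theta>"
    using none unfolding tall_pushing_up_def by blast
  \<comment> \<open>\<open>T \<kappa>\<close> is an ordinal up to which \<kappa> fails to push
    \<delta>.\<close>
  then obtain T where "\<forall>\<kappa>\<in>?K. Ord (T \<kappa>) \<and> \<not> ?emb \<kappa> (T \<kappa>)" by (rule bchoice[THEN exE])
  then have T: "Ord (T \<kappa>) \<and> \<not> ?emb \<kappa> (T \<kappa>)" if "\<kappa> \<in> ?K" for \<kappa> using that by (rule bspec)
  have "small ?K" by (rule small_subset[OF small_Pow[OF small_elts[of \<delta>]]]) auto
  then have sm: "small ({\<delta>} \<union> T ` ?K)" by (intro small_Un small_image small_sing)
  \<comment> \<open>The candidates \<kappa> are subsets of \<delta> and so form a set; thus all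
    failures have a common bound, chosen to be at least \<delta>.\<close>
  define \<theta> where "\<theta> = set_of (\<Union>x\<in>{\<delta>} \<union> T ` ?K. elts x)"
  have elts_\<theta>: "elts \<theta> = (\<Union>x\<in>{\<delta>} \<union> T ` ?K. elts x)"
    unfolding \<theta>_def by (rule elts_set_of, rule small_Union, rule sm)
  have "Ord \<theta>" unfolding \<theta>_def
    by (rule Ord_set_of_UN[OF sm]) (use \<delta> T in \<open>auto simp: Card_def\<close>)
  moreover have "elts \<delta> \<subseteq> elts \<theta>" using elts_\<theta> by blast
  ultimately obtain \<kappa> j M where \<kappa>: "\<kappa> \<in> ?K" and j: "critical_point j \<kappa>" "trans_class M"
    "elem_embedding j M" "closed_under_less_seqs M \<eta>" "\<theta> \<in> elts (j \<delta>)" "Ord (j \<delta>)"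
    using SULST_embedding[OF \<eta>(1) assms(2) \<delta> \<eta>\<delta> SULST] by blast
  have "elts (T \<kappa>) \<subseteq> elts \<theta>" using elts_\<theta> \<kappa> by blast
  \<comment> \<open>An embedding with critical point \<kappa> that reaches \<theta> also passes the
    smaller ordinal \<open>T \<kappa>\<close>, contrary to its choice.\<close>
  then have "T \<kappa> \<in> elts (j \<delta>)"
    using Ord_subset_mem T[OF \<kappa>] \<open>Ord \<theta>\<close> j(5,6) by blast
  then show False using T[OF \<kappa>] j by blast
qed

end
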